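(* Let $G$ be a $3$-colorable planar graph. Then $\vec{\chi}(G)\le 11$. Moreover, if $G$ is outerplanar, then $\vec{\chi}(G)\le 10$.
   Context: All graphs are finite and simple. An orientation of $G$ chooses a direction for each edge; $d^+(v)$ is the number of edges directed out of $v$. An orientation is proper if $d^+(u)\neq d^+(v)$ for every edge $uv$. The proper orientation number $\vec{\chi}(G)$ is the minimum, over all proper orientations of $G$, of $\max_{v\in V(G)} d^+(v)$ (every graph has a proper orientation). *)

theory Defs
  imports "HOL-Analysis.Analysis"
begin

definition simple_graph :: "'a set \<Rightarrow> 'a set set \<Rightarrow> bool" where
  "simple_graph V E \<longleftrightarrow> finite V \<and> (\<forall>e\<in>E. e \<subseteq> V \<and> card e = 2)"

definition colorable :: "nat \<Rightarrow> 'a set \<Rightarrow> 'a set set \<Rightarrow> bool" where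
  "colorable k V E \<longleftrightarrow>
     (\<exists>c :: 'a \<Rightarrow> nat. (\<forall>v\<in>V. c v < k) \<and> (\<forall>u v. {u, v} \<in> E \<longrightarrow> c u \<noteq> c v))"

(* An orientation is a set of arcs (u, v), read "directed from u to v". *)

definition orientation :: "'a set set \<Rightarrow> ('a \<times> 'a) set \<Rightarrow> bool" where
  "orientation E D \<longleftrightarrow>
     (\<forall>(u, v)\<in>D. {u, v} \<in> E) \<and>
     (\<forall>u v. {u, v} \<in> E \<longrightarrow> ((u, v) \<in> D \<longleftrightarrow> (v, u) \<notin> D))"

definition outdeg :: "('a \<times> 'a) set \<Rightarrow> 'a \<Rightarrow> nat" where
  "outdeg D v = card {w. (v, w) \<in> D}"

definition proper_orientation :: "'a set set \<Rightarrow> ('a \<times> 'a) set \<Rightarrow> bool" where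
  "proper_orientation E D \<longleftrightarrow>
     orientation E D \<and> (\<forall>u v. {u, v} \<in> E \<longrightarrow> outdeg D u \<noteq> outdeg D v)"

(* Inserting 0 only matters for the graph without vertices. *)

definition max_outdeg :: "'a set \<Rightarrow> ('a \<times> 'a) set \<Rightarrow> nat" where
  "max_outdeg V D = Max (insert 0 (outdeg D ` V))"

definition proper_orientation_number :: "'a set \<Rightarrow> 'a set set \<Rightarrow> nat" where
  "proper_orientation_number V E =
     (LEAST k. \<exists>D. proper_orientation E D \<and> max_outdeg V D = k)"

(* The plane is the type complex. Distinct edges meet exactly in the images of their
   common endpoints, and an edge passes through no vertices other than its endpoints. *)

definition plane_drawing ::
    "'a set \<Rightarrow> 'a set set \<Rightarrow> ('a \<Rightarrow> complex) \<Rightarrow> ('a set \<Rightarrow> real \<Rightarrow> complex) \<Rightarrow> bool" where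
  "plane_drawing V E pos \<gamma> \<longleftrightarrow>
     inj_on pos V \<and>
     (\<forall>e\<in>E. arc (\<gamma> e) \<and> {pathstart (\<gamma> e), pathfinish (\<gamma> e)} = pos ` e \<and>
             path_image (\<gamma> e) \<inter> pos ` V = pos ` e) \<and>
     (\<forall>e\<in>E. \<forall>f\<in>E. e \<noteq> f \<longrightarrow> path_image (\<gamma> e) \<inter> path_image (\<gamma> f) = pos ` (e \<inter> f))"

definition drawing_points ::
    "'a set \<Rightarrow> 'a set set \<Rightarrow> ('a \<Rightarrow> complex) \<Rightarrow> ('a set \<Rightarrow> real \<Rightarrow> complex) \<Rightarrow> complex set" where
  "drawing_points V E pos \<gamma> = pos ` V \<union> (\<Union>e\<in>E. path_image (\<gamma> e))"

definition planar :: "'a set \<Rightarrow> 'a set set \<Rightarrow> bool" where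
  "planar V E \<longleftrightarrow> (\<exists>pos \<gamma>. plane_drawing V E pos \<gamma>)"

(* The drawing is compact, so its outside is the unbounded face of the drawing. *)

definition outerplanar :: "'a set \<Rightarrow> 'a set set \<Rightarrow> bool" where
  "outerplanar V E \<longleftrightarrow>
     (\<exists>pos \<gamma>. plane_drawing V E pos \<gamma> \<and>
        pos ` V \<subseteq> frontier (outside (drawing_points V E pos \<gamma>)))"

end

theory Submission
  imports Defs
begin

text \<open>
The bounds hold because outerplanar and planar graphs, and all their subgraphs, have few edges: a
plane graph with $n \geq 1$ vertices has fewer than $3n$ edges, an outerplane one at most $2n$.
The combinatorial core, \<open>proper_orientation_number_le\<close>, says that a 3-colourable graph in which
every nonempty vertex set $X$ spans fewer than $3|X|$ and at most $k|X|$ edges has a proper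
orientation with outdegrees at most $k + 8$. The two claims are the cases $k = 3$ and $k = 2$.

\<^bold>\<open>Assigning outdegrees.\<close> Outdegrees are assigned from the top down. For the current value $x$, an
independent set of remaining vertices is picked that get outdegree exactly $x$; their undecided edges
are directed outwards, and the procedure goes on with $x - 1$. The \<open>potential\<close> of a vertex is its
outdegree so far plus the number of its undecided edges. A picked vertex of potential above $x$ has
to give up the surplus, that is, to let some of its edges be directed towards it. A guiding
orientation $D$ with outdegrees at most $k$, which exists by the density bound
(\<open>bounded_orientation\<close>), says which ones: only edges that $D$ directs into the vertex may be given up.
So a vertex receives at most as many edges as its outdegree in $D$, and conversely, by
\<open>pot_le_in_nbrs\<close>, a vertex of high potential has many edges that it may give up.

The potential of the vertices that are not picked has to come down with the current value. It drops
by one for each edge to a picked vertex that is not given up. An edge is unsafe to give up if it would be the only edge to the picked set of a vertex that needs to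
drop. A vertex with potential $x + 1$ and without picked neighbours is refused, that is, cannot be picked,
only if all its edges from in-neighbours are unsafe in this sense. Hence, if the colour classes are picked one after the other in a suitable order, either the
in-neighbours of the refused vertex are picked later in the same round, and then its potential drops
by far more than needed, or the refused vertices form a set closed under in-neighbours whose members
all have at least three of them; the latter is impossible as such a set would span too many edges.
Eight rounds, at the values $k + 8, \dots, k + 1$, bring all potentials down to $k$
(\<open>completable_three_classes\<close>), and from there the greedy procedure ends by itself
(\<open>completable_flat\<close>).

\<^bold>\<open>Counting edges.\<close> For a drawing by arcs, the edge bounds follow from Euler's inequality, which is
proved by adding the edges one by one: an edge between two pieces of the drawing unites them, and an
edge within a piece closes a Jordan curve and so splits a face (\<open>many_faces\<close>). By Janiszewski's
theorem an edge lies on at most two faces (\<open>edge_touches_two_faces\<close>), and two edges do not separate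
the plane, whence a face has at least three edges (\<open>face_has_three_edges\<close>). Double counting gives the
bound for plane graphs. In an outerplane graph of minimum degree two, each vertex has two
incident edges on the unbounded face (\<open>boundary_at_vertex\<close>), so that this face has at
least $n$ edges, and the count improves to $2n$; vertices of smaller degree are removed first
(\<open>outer_edge_bound\<close>).
\<close>

section \<open>Orientations of bounded outdegree\<close>

lemma graph_facts:
  assumes "simple_graph V E"
  shows graph_finite: "finite V" "finite E"
    and graph_no_loop: "{v} \<notin> E" and graph_vertex: "{u, v} \<in> E \<Longrightarrow> u \<in> V \<and> v \<in> V \<and> u \<noteq> v"
  using assms finite_subset[of E "Pow V"] by (auto simp: simple_graph_def)

text \<open>A theorem of Hakimi: the obvious necessary condition on the outdegrees suffices. As in proofs of Hall's
theorem, an edge is directed out of one of its ends and the bound of this end is lowered, which is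
harmless unless some tight set contains this end but not the other.\<close>

lemma bounded_orientation:
  fixes b :: "'a \<Rightarrow> nat"
  assumes "simple_graph V E" and "\<And>X. X \<subseteq> V \<Longrightarrow> card {e \<in> E. e \<subseteq> X} \<le> sum b X"
  shows "\<exists>D. orientation E D \<and> (\<forall>v\<in>V. outdeg D v \<le> b v)"
  using graph_finite(2)[OF assms(1)] assms
proof (induction E arbitrary: b rule: finite_psubset_induct)
  case (psubset E)
  note G = psubset.prems(1) and bound = psubset.prems(2)
  have fV: "finite V" using graph_finite(1)[OF G] .
  show ?case
  proof (cases "E = {}")
    case True
    then show ?thesis by (intro exI[of _ "{}"]) (auto simp: orientation_def outdeg_def)
  next
    case False
    then obtain e0 where "e0 \<in> E" by blast
    then obtain u0 v0 where e0: "{u0, v0} \<in> E"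
      using G by (auto simp: simple_graph_def card_2_iff)
    define tight where "tight X \<longleftrightarrow> X \<subseteq> V \<and> card {e \<in> E. e \<subseteq> X} = sum b X" for X
    \<comment> \<open>If both directions of an edge are blocked, by tight sets $X$ and $Y$, then the bound fails for
      $X \cup Y$, which spans the edge in addition to everything that $X$ and $Y$ span.\<close>
    have "\<exists>u v. {u, v} \<in> E \<and> (\<forall>X. tight X \<longrightarrow> u \<in> X \<longrightarrow> v \<in> X)"
    proof (rule ccontr)
      assume none: "\<nexists>u v. {u, v} \<in> E \<and> (\<forall>X. tight X \<longrightarrow> u \<in> X \<longrightarrow> v \<in> X)"
      have "{v0, u0} \<in> E" using e0 by (simp add: insert_commute)
      then obtain X Y where X: "tight X" "u0 \<in> X" "v0 \<notin> X" and Y: "tight Y" "v0 \<in> Y" "u0 \<notin> Y"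
        using none e0 by metis
      have sub: "X \<subseteq> V" "Y \<subseteq> V" and fin: "finite X" "finite Y"
        using X Y fV by (auto simp: tight_def intro: finite_subset)
      let ?e = "\<lambda>X. {e \<in> E. e \<subseteq> X}"
      have fe: "finite (?e Z)" for Z using psubset.hyps by simp
      have "?e X \<inter> ?e Y = ?e (X \<inter> Y)" by auto
      then have "card (?e X) + card (?e Y) = card (?e X \<union> ?e Y) + card (?e (X \<inter> Y))"
        using card_Un_Int[OF fe fe, of X Y] by simp
      moreover have "card (insert {u0, v0} (?e X \<union> ?e Y)) \<le> card (?e (X \<union> Y))"
        using e0 X Y fe by (intro card_mono) auto
      moreover have "{u0, v0} \<notin> ?e X \<union> ?e Y" using X Y by simp
      ultimately have "card (?e X) + card (?e Y) < card (?e (X \<union> Y)) + card (?e (X \<inter> Y))"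
        using fe by simp
      moreover have "card (?e (X \<union> Y)) \<le> sum b (X \<union> Y)" "card (?e (X \<inter> Y)) \<le> sum b (X \<inter> Y)"
        by (rule bound, use sub in blast)+
      moreover have "sum b (X \<union> Y) + sum b (X \<inter> Y) = sum b X + sum b Y"
        using sum.union_inter[OF fin] .
      ultimately show False using X Y by (simp add: tight_def)
    qed
    then obtain u v where e: "{u, v} \<in> E" and tight: "\<And>X. tight X \<Longrightarrow> u \<in> X \<Longrightarrow> v \<in> X"
      by blast
    note uv = graph_vertex[OF G e]
    have "\<not> tight {u}" using tight[of "{u}"] uv by blast
    then have bu: "0 < b u" using bound[of "{u}"] uv by (auto simp: tight_def)
    let ?E = "E - {{u, v}}" and ?b = "b(u := b u - 1)"
    have "\<exists>D. orientation ?E D \<and> (\<forall>x\<in>V. outdeg D x \<le> ?b x)"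
    proof (rule psubset.IH)
      show "?E \<subset> E" using e by blast
      show "simple_graph V ?E" using G by (auto simp: simple_graph_def)
      fix X assume XV: "X \<subseteq> V"
      have fX: "finite X" using XV fV finite_subset by blast
      have fe: "finite {f \<in> E. f \<subseteq> X}" using psubset.hyps by simp
      have le: "card {f \<in> E. f \<subseteq> X} \<le> sum b X" using bound XV by blast
      show "card {f \<in> ?E. f \<subseteq> X} \<le> sum ?b X"
      proof (cases "u \<in> X")
        case False
        then have "sum ?b X = sum b X" by (intro sum.cong) auto
        moreover have "{f \<in> ?E. f \<subseteq> X} = {f \<in> E. f \<subseteq> X}" using False by auto
        ultimately show ?thesis using le by simp
      next
        case True
        have "sum ?b (X - {u}) = sum b (X - {u})" by (intro sum.cong) auto
        then have s: "sum ?b X + 1 = sum b X"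
          using sum.remove[OF fX True, of b] sum.remove[OF fX True, of ?b] bu by simp
        show ?thesis
        proof (cases "v \<in> X")
          case True
          have "{f \<in> ?E. f \<subseteq> X} = {f \<in> E. f \<subseteq> X} - {{u, v}}" by auto
          then show ?thesis using e True \<open>u \<in> X\<close> fe le s by simp
        next
          case False
          then have "\<not> tight X" using tight True by blast
          moreover have "{f \<in> ?E. f \<subseteq> X} = {f \<in> E. f \<subseteq> X}" using False by auto
          ultimately show ?thesis using le s XV by (simp add: tight_def)
        qed
      qed
    qed
    then obtain D where D: "orientation ?E D" and Db: "\<And>x. x \<in> V \<Longrightarrow> outdeg D x \<le> ?b x"
      by blast
    have notin: "(u, v) \<notin> D" "(v, u) \<notin> D"
      using D by (auto simp: orientation_def insert_commute)
    have "finite {w. (u, w) \<in> D}"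
    proof (rule finite_subset[OF _ fV])
      show "{w. (u, w) \<in> D} \<subseteq> V" using D graph_vertex[OF G] by (auto simp: orientation_def)
    qed
    moreover have "{w. (u, w) \<in> insert (u, v) D} = insert v {w. (u, w) \<in> D}" by auto
    ultimately have "outdeg (insert (u, v) D) u = outdeg D u + 1"
      using notin by (simp add: outdeg_def)
    moreover have "outdeg (insert (u, v) D) x = outdeg D x" if "x \<noteq> u" for x
      using that by (simp add: outdeg_def)
    ultimately have "outdeg (insert (u, v) D) x \<le> b x" if "x \<in> V" for x
      using Db[OF that] bu by (cases "x = u") auto
    moreover have "orientation E (insert (u, v) D)"
      using D notin e uv unfolding orientation_def by (auto simp: doubleton_eq_iff)
    ultimately show ?thesis by blast
  qed
qed

section \<open>Assigning outdegrees from the top\<close>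

text \<open>The value \<open>own v\<close> is the number of edges from \<open>v\<close> to vertices already removed that are directed out of
\<open>v\<close>; so the potential is the largest outdegree that \<open>v\<close> can still reach within the remaining set \<open>W\<close>.\<close>

definition potential :: "'a set set \<Rightarrow> 'a set \<Rightarrow> ('a \<Rightarrow> nat) \<Rightarrow> 'a \<Rightarrow> nat" where
  "potential E W own v = own v + card {w \<in> W. {v, w} \<in> E}"

text \<open>Here \<open>x\<close> bounds all outdegrees of the remaining vertices, so that vertices of outdegree above \<open>x\<close>,
removed earlier, cannot conflict with them.\<close>

definition completable :: "'a set set \<Rightarrow> 'a set \<Rightarrow> ('a \<Rightarrow> nat) \<Rightarrow> nat \<Rightarrow> bool" where
  "completable E W own x \<longleftrightarrow>
     (\<exists>A. orientation {e \<in> E. e \<subseteq> W} A \<and> (\<forall>v\<in>W. own v + outdeg A v \<le> x) \<and>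
          (\<forall>u\<in>W. \<forall>v\<in>W. {u, v} \<in> E \<longrightarrow> own u + outdeg A u \<noteq> own v + outdeg A v))"

text \<open>The vertices of \<open>I\<close> get outdegree exactly \<open>x\<close>. The pairs in \<open>F\<close> are the edges that they give up,
written with the receiving vertex first; all other edges at \<open>I\<close> are directed out of \<open>I\<close>.\<close>

definition picks ::
  "'a set set \<Rightarrow> 'a set \<Rightarrow> ('a \<Rightarrow> nat) \<Rightarrow> nat \<Rightarrow> 'a set \<Rightarrow> ('a \<times> 'a) set \<Rightarrow> bool" where
  "picks E W own x I F \<longleftrightarrow>
     I \<subseteq> W \<and> (\<forall>u\<in>I. \<forall>v\<in>I. {u, v} \<notin> E) \<and>
     F \<subseteq> (W - I) \<times> I \<and> (\<forall>(w, v)\<in>F. {w, v} \<in> E) \<and>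
     (\<forall>v\<in>I. potential E W own v = x + card {w. (w, v) \<in> F})"

definition credit :: "('a \<Rightarrow> nat) \<Rightarrow> ('a \<times> 'a) set \<Rightarrow> 'a \<Rightarrow> nat" where
  "credit own F w = own w + card {v. (w, v) \<in> F}"

lemma potential_credit:
  assumes "finite W" "picks E W own x I F" "w \<in> W - I"
  shows "potential E (W - I) (credit own F) w + card {v \<in> I. {w, v} \<in> E \<and> (w, v) \<notin> F} = potential E W own w"
proof -
  have I: "I \<subseteq> W" and F: "F \<subseteq> (W - I) \<times> I" and FE: "\<forall>(w, v)\<in>F. {w, v} \<in> E"
    using assms(2) by (auto simp: picks_def)
  have fI: "finite I" using I assms(1) finite_subset by blast
  have "{v \<in> W. {w, v} \<in> E} = {v \<in> W - I. {w, v} \<in> E} \<union> {v. (w, v) \<in> F}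
          \<union> {v \<in> I. {w, v} \<in> E \<and> (w, v) \<notin> F}" (is "?L = ?A \<union> ?B \<union> ?C")
    using I F FE by auto
  moreover have "finite ?A" "finite ?B" "finite ?C"
    using assms(1) fI F by (auto intro: finite_subset[of ?B I])
  moreover have "?A \<inter> ?B = {}" "(?A \<union> ?B) \<inter> ?C = {}" using F by auto
  ultimately have "card ?L = card ?A + card ?B + card ?C"
    by (simp add: card_Un_disjoint)
  then show ?thesis by (simp add: potential_def credit_def)
qed

lemma completable_picks:
  assumes fin: "finite W"
    and p: "picks E W own x I F" and c: "completable E (W - I) (credit own F) (x - 1)" and "0 < x"
  shows "completable E W own x"
proof -
  have I: "I \<subseteq> W" and ind: "\<And>u v. u \<in> I \<Longrightarrow> v \<in> I \<Longrightarrow> {u, v} \<notin> E"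
    and F: "F \<subseteq> (W - I) \<times> I" and FE: "\<And>w v. (w, v) \<in> F \<Longrightarrow> {w, v} \<in> E"
    and val: "\<And>v. v \<in> I \<Longrightarrow> potential E W own v = x + card {w. (w, v) \<in> F}"
    using p by (auto simp: picks_def)
  obtain A where A: "orientation {e \<in> E. e \<subseteq> W - I} A"
    and Ax: "\<forall>v\<in>W - I. credit own F v + outdeg A v \<le> x - 1"
    and Ap: "\<forall>u\<in>W - I. \<forall>v\<in>W - I. {u, v} \<in> E \<longrightarrow>
               credit own F u + outdeg A u \<noteq> credit own F v + outdeg A v"
    using c unfolding completable_def by blast
  have Asub: "A \<subseteq> (W - I) \<times> (W - I)" and AE: "\<And>u v. (u, v) \<in> A \<Longrightarrow> {u, v} \<in> E"
    using A by (auto simp: orientation_def)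
  have Aone: "\<And>u v. u \<in> W - I \<Longrightarrow> v \<in> W - I \<Longrightarrow> {u, v} \<in> E \<Longrightarrow> (u, v) \<in> A \<longleftrightarrow> (v, u) \<notin> A"
    using A by (auto simp: orientation_def)
  define G where "G = {(v, w). v \<in> I \<and> w \<in> W - I \<and> {v, w} \<in> E \<and> (w, v) \<notin> F}"
  define B where "B = A \<union> F \<union> G"
  have oB: "orientation {e \<in> E. e \<subseteq> W} B"
    unfolding orientation_def
  proof (intro conjI ballI allI impI)
    fix a assume "a \<in> B"
    then show "case a of (u, v) \<Rightarrow> {u, v} \<in> {e \<in> E. e \<subseteq> W}"
      using Asub AE F FE I by (auto simp: B_def G_def)
  next
    fix u v assume uv: "{u, v} \<in> {e \<in> E. e \<subseteq> W}"
    then have uvW: "u \<in> W" "v \<in> W" and e: "{u, v} \<in> E" and e': "{v, u} \<in> E"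
      by (auto simp: insert_commute)
    have "\<not> (u \<in> I \<and> v \<in> I)" using ind e by blast
    then show "((u, v) \<in> B) = ((v, u) \<notin> B)"
      using uvW e e' Asub F Aone[of u v] by (auto simp: B_def G_def)
  qed
  have fI: "finite I" using I fin finite_subset by blast
  have outI: "own v + outdeg B v = x" if "v \<in> I" for v
  proof -
    have "{w. (v, w) \<in> B} = {w \<in> W. {v, w} \<in> E} - {w. (w, v) \<in> F}"
      using that Asub F I ind by (auto simp: B_def G_def)
    moreover have "{w. (w, v) \<in> F} \<subseteq> {w \<in> W. {v, w} \<in> E}"
      using F FE by (auto simp: insert_commute)
    ultimately have "outdeg B v = card {w \<in> W. {v, w} \<in> E} - card {w. (w, v) \<in> F}"
      and "card {w. (w, v) \<in> F} \<le> card {w \<in> W. {v, w} \<in> E}"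
      using fin by (auto simp: outdeg_def intro!: card_Diff_subset card_mono finite_subset[of "{w. (w, v) \<in> F}" W])
    then show ?thesis using val[OF that] by (simp add: potential_def)
  qed
  have outW: "own w + outdeg B w = credit own F w + outdeg A w" if "w \<in> W - I" for w
  proof -
    have "{v. (w, v) \<in> B} = {v. (w, v) \<in> F} \<union> {v. (w, v) \<in> A}"
      using that F by (auto simp: B_def G_def)
    moreover have "finite {v. (w, v) \<in> F}" using F fI by (auto intro: finite_subset[of _ I])
    moreover have "finite {v. (w, v) \<in> A}" using Asub fin by (auto intro: finite_subset[of _ W])
    moreover have "{v. (w, v) \<in> F} \<inter> {v. (w, v) \<in> A} = {}" using F Asub by auto
    ultimately show ?thesis by (simp add: outdeg_def credit_def card_Un_disjoint)
  qed
  show ?thesis unfolding completable_def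
  proof (intro exI[of _ B] conjI oB ballI impI)
    fix v assume "v \<in> W"
    then show "own v + outdeg B v \<le> x"
      using outI[of v] outW[of v] Ax by (cases "v \<in> I") force+
  next
    fix u v assume uv: "u \<in> W" "v \<in> W" "{u, v} \<in> E"
    have lt: "own w + outdeg B w < x" if "w \<in> W - I" for w
    proof -
      have "credit own F w + outdeg A w \<le> x - 1" using Ax that by blast
      then show ?thesis using outW[OF that] \<open>0 < x\<close> by linarith
    qed
    show "own u + outdeg B u \<noteq> own v + outdeg B v"
    proof (cases "u \<in> I")
      case True
      then have "v \<notin> I" using ind uv by blast
      then show ?thesis using outI[OF True] lt[of v] uv by simp
    next
      case False
      show ?thesis
      proof (cases "v \<in> I")
        case True then show ?thesis using outI[OF True] lt[of u] uv False by simp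
      next
        case F: False then show ?thesis using outW[of u] outW[of v] Ap uv False by simp
      qed
    qed
  qed
qed

text \<open>The set \<open>S\<close> consists of the vertices whose potential has to drop when it is at least the current value: as
soon as such a vertex has a neighbour in \<open>I\<close>, at least one of its edges is directed towards it for
good. Edges are given up only along arcs of \<open>D\<close>, which point into \<open>I\<close>.\<close>

definition guarded ::
  "'a set set \<Rightarrow> ('a \<times> 'a) set \<Rightarrow> 'a set \<Rightarrow> ('a \<Rightarrow> nat) \<Rightarrow> nat \<Rightarrow> 'a set \<Rightarrow> 'a set \<Rightarrow> bool" where
  "guarded E D W own x S I \<longleftrightarrow>
     (\<exists>F. picks E W own x I F \<and> F \<subseteq> D \<and>
          (\<forall>w\<in>S - I. x \<le> potential E W own w \<longrightarrow> (\<exists>v\<in>I. {w, v} \<in> E) \<longrightarrow>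
             (\<exists>v\<in>I. {w, v} \<in> E \<and> (w, v) \<notin> F)))"

definition untouched :: "'a set set \<Rightarrow> 'a set \<Rightarrow> 'a \<Rightarrow> bool" where
  "untouched E I v \<longleftrightarrow> (\<forall>u\<in>I. {v, u} \<notin> E)"

lemma guarded_empty: "guarded E D W own x S {}"
  by (auto simp: guarded_def picks_def intro!: exI[of _ "{}"])

text \<open>The surplus of \<open>v\<close> is given up along arcs of \<open>D\<close> that start in vertices which can afford to receive an
edge: either they need not drop, or they already have a neighbour in \<open>I\<close> and hence lose an edge to it.\<close>

lemma guarded_insert:
  assumes loop: "\<And>v. {v} \<notin> E" and DE: "\<And>u v. (u, v) \<in> D \<Longrightarrow> {u, v} \<in> E"
    and g: "guarded E D W own x S I" and v: "v \<in> W" "untouched E I v" "x \<le> potential E W own v"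
    and safe: "potential E W own v \<le> x + card {w \<in> W. (w, v) \<in> D \<and>
        \<not> (w \<in> S \<and> x \<le> potential E W own w \<and> untouched E I w)}"
  shows "guarded E D W own x S (insert v I)"
proof -
  obtain F where p: "picks E W own x I F" and FD: "F \<subseteq> D"
    and drop: "\<forall>w\<in>S - I. x \<le> potential E W own w \<longrightarrow> (\<exists>v\<in>I. {w, v} \<in> E) \<longrightarrow>
             (\<exists>v\<in>I. {w, v} \<in> E \<and> (w, v) \<notin> F)"
    using g unfolding guarded_def by (elim exE conjE)
  have I: "I \<subseteq> W" and ind: "\<forall>u\<in>I. \<forall>v\<in>I. {u, v} \<notin> E"
    and F: "F \<subseteq> (W - I) \<times> I" and FE: "\<forall>(w, v)\<in>F. {w, v} \<in> E"
    and val: "\<forall>v\<in>I. potential E W own v = x + card {w. (w, v) \<in> F}"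
    using p unfolding picks_def by simp_all
  obtain Y where Y: "Y \<subseteq> {w \<in> W. (w, v) \<in> D \<and> \<not> (w \<in> S \<and> x \<le> potential E W own w \<and> untouched E I w)}"
    and Yc: "card Y = potential E W own v - x" and "finite Y"
  proof -
    have "potential E W own v - x \<le> card {w \<in> W. (w, v) \<in> D \<and> \<not> (w \<in> S \<and> x \<le> potential E W own w \<and> untouched E I w)}"
      using safe by linarith
    then show thesis using that by (elim obtain_subset_with_card_n)
  qed
  have vfree: "\<And>u. u \<in> I \<Longrightarrow> {v, u} \<notin> E" "\<And>u. u \<in> I \<Longrightarrow> {u, v} \<notin> E"
    using v by (auto simp: untouched_def insert_commute)
  show ?thesis
  proof (cases "v \<in> I")
    case True then show ?thesis using g by (simp add: insert_absorb)
  next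
    case False
    have YI: "Y \<inter> I = {}" using Y DE vfree by fastforce
    have vY: "v \<notin> Y" using Y DE loop by fastforce
    have vF: "(v, u) \<notin> F" "(u, v) \<notin> F" for u using F FE vfree False by fastforce+
    let ?F = "F \<union> Y \<times> {v}"
    have "picks E W own x (insert v I) ?F"
      unfolding picks_def
    proof (intro conjI)
      show "insert v I \<subseteq> W" using I v by simp
      show "\<forall>a\<in>insert v I. \<forall>b\<in>insert v I. {a, b} \<notin> E" using ind vfree loop by auto
      show "?F \<subseteq> (W - insert v I) \<times> insert v I" using F Y YI vY vF by fastforce
      show "\<forall>(w, v)\<in>?F. {w, v} \<in> E" using FE Y DE by fastforce
      show "\<forall>u\<in>insert v I. potential E W own u = x + card {w. (w, u) \<in> ?F}"
      proof
        fix u assume u: "u \<in> insert v I"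
        show "potential E W own u = x + card {w. (w, u) \<in> ?F}"
        proof (cases "u = v")
          case True
          have "{w. (w, v) \<in> ?F} = Y" using vF by auto
          then show ?thesis using True Yc v by simp
        next
          case uv: False
          then have "{w. (w, u) \<in> ?F} = {w. (w, u) \<in> F}" by auto
          then show ?thesis using u uv val by simp
        qed
      qed
    qed
    moreover have "?F \<subseteq> D" using FD Y by auto
    moreover have "\<forall>w\<in>S - insert v I. x \<le> potential E W own w \<longrightarrow> (\<exists>u\<in>insert v I. {w, u} \<in> E) \<longrightarrow>
             (\<exists>u\<in>insert v I. {w, u} \<in> E \<and> (w, u) \<notin> ?F)"
    proof (intro ballI impI)
      fix w assume w: "w \<in> S - insert v I" "x \<le> potential E W own w" "\<exists>u\<in>insert v I. {w, u} \<in> E"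
      show "\<exists>u\<in>insert v I. {w, u} \<in> E \<and> (w, u) \<notin> ?F"
      proof (cases "\<exists>u\<in>I. {w, u} \<in> E")
        case True
        then obtain u where "u \<in> I" "{w, u} \<in> E" "(w, u) \<notin> F" using drop w by blast
        then show ?thesis using False by auto
      next
        case fr: False
        then have "untouched E I w" by (auto simp: untouched_def)
        then have "w \<notin> Y" using Y w by auto
        then show ?thesis using w fr vF by auto
      qed
    qed
    ultimately show ?thesis unfolding guarded_def by blast
  qed
qed

lemma guarded_extend:
  assumes fin: "finite W" and loop: "\<And>v. {v} \<notin> E" and DE: "\<And>u v. (u, v) \<in> D \<Longrightarrow> {u, v} \<in> E"
    and g: "guarded E D W own x S I" and P: "P \<subseteq> W"
  obtains J where "guarded E D W own x S J" "I \<subseteq> J" "J \<subseteq> I \<union> P"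
    "\<And>v. v \<in> P - J \<Longrightarrow> untouched E J v \<Longrightarrow> x \<le> potential E W own v \<Longrightarrow>
       x + card {w \<in> W. (w, v) \<in> D \<and> \<not> (w \<in> S \<and> x \<le> potential E W own w \<and> untouched E J w)} < potential E W own v"
proof -
  have IW: "I \<subseteq> W" using g by (auto simp: guarded_def picks_def)
  let ?C = "{J. guarded E D W own x S J \<and> I \<subseteq> J \<and> J \<subseteq> I \<union> P}"
  have "?C \<subseteq> Pow W" using IW P by auto
  then have "finite ?C" using fin finite_subset by blast
  moreover have "I \<in> ?C" using g by auto
  ultimately obtain J where J: "J \<in> ?C" and mx: "\<forall>J'\<in>?C. J \<subseteq> J' \<longrightarrow> J = J'"
    using finite_has_maximal[of ?C] by (metis (no_types, lifting) empty_iff)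
  show thesis
  proof (rule that[of J])
    fix v assume v: "v \<in> P - J" "untouched E J v" "x \<le> potential E W own v"
    show "x + card {w \<in> W. (w, v) \<in> D \<and> \<not> (w \<in> S \<and> x \<le> potential E W own w \<and> untouched E J w)} < potential E W own v"
    proof (rule ccontr)
      assume "\<not> ?thesis"
      then have "guarded E D W own x S (insert v J)"
        using guarded_insert[OF loop DE, of D W own x S J v] J v P by auto
      then have "insert v J \<in> ?C" using J v by auto
      then have "J = insert v J" using mx by blast
      then show False using v by blast
    qed
  qed (use J in auto)
qed

text \<open>When no potential exceeds \<open>x\<close>, nothing has to be given up: a maximal independent set of vertices of
potential \<open>x\<close> gets outdegree \<open>x\<close>, and all other vertices of potential \<open>x\<close> are adjacent to it and drop.
This is the greedy procedure with \<open>D = {}\<close>.\<close>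

lemma completable_flat:
  assumes fin: "finite W" and loop: "\<And>v. {v} \<notin> E" and "\<And>v. v \<in> W \<Longrightarrow> potential E W own v \<le> x"
  shows "completable E W own x"
  using assms(1,3)
proof (induction x arbitrary: W own)
  case 0
  then have z: "own v = 0" "{w \<in> W. {v, w} \<in> E} = {}" if "v \<in> W" for v
    using that by (fastforce simp: potential_def)+
  have "{e \<in> E. e \<subseteq> W} \<inter> {{u, v} |u v. True} = {}" using z by fastforce
  then have "orientation {e \<in> E. e \<subseteq> W} {}" unfolding orientation_def by blast
  then show ?case using z unfolding completable_def
    by (intro exI[of _ "{}"]) (auto simp: outdeg_def)
next
  case (Suc x)
  obtain J where J: "guarded E {} W own (Suc x) W J"
    and mx: "\<And>v. v \<in> W - J \<Longrightarrow> untouched E J v \<Longrightarrow> Suc x \<le> potential E W own v \<Longrightarrow> Suc x < potential E W own v"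
  proof (rule guarded_extend[OF Suc.prems(1) loop _ guarded_empty[of E "{}" W own "Suc x" W] subset_refl])
    fix J
    assume J: "guarded E {} W own (Suc x) W J"
      and mx: "\<And>v. v \<in> W - J \<Longrightarrow> untouched E J v \<Longrightarrow> Suc x \<le> potential E W own v \<Longrightarrow>
       Suc x + card {w \<in> W. (w, v) \<in> {} \<and> \<not> (w \<in> W \<and> Suc x \<le> potential E W own w \<and> untouched E J w)} < potential E W own v"
    show thesis
    proof (rule that[OF J])
      fix v assume "v \<in> W - J" "untouched E J v" "Suc x \<le> potential E W own v"
      from mx[OF this] show "Suc x < potential E W own v" by linarith
    qed
  qed auto
  obtain F where p: "picks E W own (Suc x) J F" and F: "F \<subseteq> {}"
    and drop: "\<forall>w\<in>W - J. Suc x \<le> potential E W own w \<longrightarrow> (\<exists>v\<in>J. {w, v} \<in> E) \<longrightarrow>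
             (\<exists>v\<in>J. {w, v} \<in> E \<and> (w, v) \<notin> F)"
    using J unfolding guarded_def by (elim exE conjE)
  have "potential E (W - J) (credit own F) w \<le> x" if w: "w \<in> W - J" for w
  proof (cases "Suc x \<le> potential E W own w")
    case False
    then show ?thesis using potential_credit[OF Suc.prems(1) p w] by linarith
  next
    case True
    have "\<not> untouched E J w" using mx[OF w _ True] Suc.prems(2)[of w] w by auto
    then have "\<exists>v\<in>J. {w, v} \<in> E \<and> (w, v) \<notin> F" using drop w True by (auto simp: untouched_def)
    moreover have "finite J" using p Suc.prems(1) by (auto simp: picks_def intro: finite_subset)
    ultimately have "card {v \<in> J. {w, v} \<in> E \<and> (w, v) \<notin> F} > 0" by (auto simp: card_gt_0_iff)
    then show ?thesis using potential_credit[OF Suc.prems(1) p w] Suc.prems(2)[of w] w by auto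
  qed
  then have "completable E (W - J) (credit own F) x" using Suc.IH[of "W - J"] Suc.prems(1) by blast
  then show ?case using completable_picks[OF Suc.prems(1) p] by simp
qed

section \<open>Descending along a guiding orientation\<close>

text \<open>The orientation \<open>D\<close> guides which edges may be given up.\<close>

locale guided_graph =
  fixes V :: "'a set" and E :: "'a set set" and D :: "('a \<times> 'a) set" and k :: nat
  assumes finV: "finite V"
    and loop: "{v} \<notin> E"
    and arc_edge: "(u, v) \<in> D \<Longrightarrow> {u, v} \<in> E"
    and edge_arc: "{u, v} \<in> E \<Longrightarrow> (u, v) \<in> D \<longleftrightarrow> (v, u) \<notin> D"
    and sparse: "T \<subseteq> V \<Longrightarrow> T \<noteq> {} \<Longrightarrow> card (D \<inter> T \<times> T) < 3 * card T"
begin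

abbreviation pot :: "'a set \<Rightarrow> ('a \<Rightarrow> nat) \<Rightarrow> 'a \<Rightarrow> nat" where
  "pot \<equiv> potential E"

definition in_nbrs :: "'a set \<Rightarrow> 'a \<Rightarrow> 'a set" where
  "in_nbrs W v = {w \<in> W. (w, v) \<in> D}"

text \<open>An edge received by a vertex is an arc of \<open>D\<close> out of it whose head is removed. Hence \<open>own v\<close> plus
the outdegree of \<open>v\<close> in what is left of \<open>D\<close> never grows, and stays at most \<open>k\<close>.\<close>

definition guided :: "'a set \<Rightarrow> ('a \<Rightarrow> nat) \<Rightarrow> bool" where
  "guided W own \<longleftrightarrow> W \<subseteq> V \<and> (\<forall>v\<in>W. own v + card {u \<in> W. (v, u) \<in> D} \<le> k)"

definition indep :: "'a set \<Rightarrow> bool" where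
  "indep X \<longleftrightarrow> (\<forall>u\<in>X. \<forall>v\<in>X. {u, v} \<notin> E)"

text \<open>One round: the vertices that get outdegree \<open>x\<close> are removed from \<open>W\<close>, leaving \<open>W'\<close>.\<close>

definition step :: "nat \<Rightarrow> 'a set \<Rightarrow> ('a \<Rightarrow> nat) \<Rightarrow> 'a set \<Rightarrow> ('a \<Rightarrow> nat) \<Rightarrow> bool" where
  "step x W own W' own' \<longleftrightarrow> W' \<subseteq> W \<and> guided W' own' \<and>
     (\<forall>w\<in>W'. pot W' own' w \<le> pot W own w) \<and>
     (completable E W' own' (x - 1) \<longrightarrow> completable E W own x)"

lemma arc_edge': "(u, v) \<in> D \<Longrightarrow> {v, u} \<in> E"
  using arc_edge by (metis insert_commute)

lemma arc_asym: "(u, v) \<in> D \<Longrightarrow> (v, u) \<notin> D"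
  using edge_arc arc_edge by blast

lemma guided_finite: "guided W own \<Longrightarrow> finite W"
  using finV by (auto simp: guided_def intro: finite_subset)

text \<open>The undecided edges that \<open>D\<close> directs out of \<open>v\<close>, together with the edges that already leave \<open>v\<close>, are
at most \<open>k\<close> in number.\<close>

lemma pot_le_in_nbrs:
  assumes "guided W own" "v \<in> W" shows "pot W own v \<le> k + card (in_nbrs W v)"
proof -
  have fW: "finite W" using assms guided_finite by blast
  have "{w \<in> W. {v, w} \<in> E} = {u \<in> W. (v, u) \<in> D} \<union> in_nbrs W v"
    using edge_arc[of v] arc_edge arc_edge' by (auto simp: in_nbrs_def)
  then have "card {w \<in> W. {v, w} \<in> E} \<le> card {u \<in> W. (v, u) \<in> D} + card (in_nbrs W v)"
    by (simp add: card_Un_le)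
  then show ?thesis using assms by (auto simp: potential_def guided_def dest!: bspec[of _ _ v])
qed

text \<open>Such a set \<open>T\<close> would span at least three edges per vertex. The bound $3|T|$ enters here; it is
the reason why stuck configurations cannot occur.\<close>

lemma no_closed_set:
  assumes "T \<subseteq> V" and "\<And>v. v \<in> T \<Longrightarrow> in_nbrs W v \<subseteq> T \<and> 3 \<le> card (in_nbrs W v)"
  shows "T = {}"
proof (rule ccontr)
  assume T: "T \<noteq> {}"
  have fT: "finite T" using assms(1) finV finite_subset by blast
  have "3 * card T = (\<Sum>v\<in>T. 3)" by simp
  also have "\<dots> \<le> (\<Sum>v\<in>T. card (in_nbrs W v))" using assms(2) by (intro sum_mono) auto
  also have "\<dots> = card (SIGMA v:T. in_nbrs W v)"
    using assms(2) fT by (subst card_SigmaI) (auto intro: finite_subset)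
  also have "\<dots> = card ((\<lambda>(v, w). (w, v)) ` (SIGMA v:T. in_nbrs W v))"
    by (rule card_image[symmetric]) (auto simp: inj_on_def)
  also have "\<dots> \<le> card (D \<inter> T \<times> T)"
    using assms(2) fT by (intro card_mono) (auto simp: in_nbrs_def)
  also have "\<dots> < 3 * card T" using sparse assms(1) T by blast
  finally show False by simp
qed

text \<open>The picked set \<open>J\<close> cannot be enlarged within \<open>P\<close>: the untouched vertices of \<open>P\<close> with potential at least
\<open>x\<close> have too few in-neighbours to which an edge may safely be given up. They are the refused vertices.\<close>

definition settled :: "'a set \<Rightarrow> ('a \<Rightarrow> nat) \<Rightarrow> nat \<Rightarrow> 'a set \<Rightarrow> 'a set \<Rightarrow> 'a set \<Rightarrow> bool" where
  "settled W own x S P J \<longleftrightarrow>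
     (\<forall>v\<in>P - J. untouched E J v \<longrightarrow> x \<le> pot W own v \<longrightarrow>
        x + card {w \<in> in_nbrs W v. \<not> (w \<in> S \<and> x \<le> pot W own w \<and> untouched E J w)} < pot W own v)"

lemma settled_extension:
  assumes "guided W own" "guarded E D W own x S I" "P \<subseteq> W"
  shows "\<exists>J. guarded E D W own x S J \<and> I \<subseteq> J \<and> J \<subseteq> I \<union> P \<and> settled W own x S P J"
proof (rule guarded_extend[OF guided_finite[OF assms(1)] loop _ assms(2,3)])
  fix J assume J: "guarded E D W own x S J" "I \<subseteq> J" "J \<subseteq> I \<union> P"
    and mx: "\<And>v. v \<in> P - J \<Longrightarrow> untouched E J v \<Longrightarrow> x \<le> pot W own v \<Longrightarrow>
       x + card {w \<in> W. (w, v) \<in> D \<and> \<not> (w \<in> S \<and> x \<le> pot W own w \<and> untouched E J w)} < pot W own v"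
  have "settled W own x S P J"
    unfolding settled_def
  proof (intro ballI impI)
    fix v assume v: "v \<in> P - J" "untouched E J v" "x \<le> pot W own v"
    have "{w \<in> in_nbrs W v. \<not> (w \<in> S \<and> x \<le> pot W own w \<and> untouched E J w)} =
      {w \<in> W. (w, v) \<in> D \<and> \<not> (w \<in> S \<and> x \<le> pot W own w \<and> untouched E J w)}"
      by (auto simp: in_nbrs_def)
    then show "x + card {w \<in> in_nbrs W v. \<not> (w \<in> S \<and> x \<le> pot W own w \<and> untouched E J w)} < pot W own v"
      using mx[of v] v by simp
  qed
  then show ?thesis using J by blast
qed (use arc_edge in auto)

text \<open>When the potential exceeds \<open>x\<close> by at most one, a single safe in-neighbour would suffice. So a refused
vertex has potential exactly \<open>x + 1\<close>, and all its in-neighbours are unsafe.\<close>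

lemma settledD:
  assumes "settled W own x S P J" "guided W own" "v \<in> P" "v \<in> W" "v \<notin> J" "untouched E J v"
    and "x \<le> pot W own v" "pot W own v \<le> x + 1"
  shows "pot W own v = x + 1"
    and "w \<in> in_nbrs W v \<Longrightarrow> w \<in> S \<and> x \<le> pot W own w \<and> untouched E J w"
proof -
  let ?U = "{w \<in> in_nbrs W v. \<not> (w \<in> S \<and> x \<le> pot W own w \<and> untouched E J w)}"
  have "x + card ?U < pot W own v" using assms unfolding settled_def by blast
  then have z: "card ?U = 0" and "pot W own v = x + 1" using assms(8) by linarith+
  have "finite (in_nbrs W v)" using guided_finite[OF assms(2)] by (simp add: in_nbrs_def)
  then have e: "?U = {}" using z by simp
  show "pot W own v = x + 1" by fact
  show "w \<in> in_nbrs W v \<Longrightarrow> w \<in> S \<and> x \<le> pot W own w \<and> untouched E J w" using e by blast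
qed

text \<open>Arcs of \<open>D\<close> that lead from \<open>I\<close> to \<open>w\<close> are never given up by \<open>I\<close>, since only arcs into \<open>I\<close> are. So \<open>w\<close>
loses at least one unit of potential for each in-neighbour in \<open>I\<close>.\<close>

lemma step_of_guarded:
  assumes g: "guided W own" and I: "guarded E D W own x S I" and "0 < x"
  obtains own' where "step x W own (W - I) own'"
    and "\<And>w. w \<in> W - I \<Longrightarrow> pot (W - I) own' w + card (I \<inter> in_nbrs W w) \<le> pot W own w"
    and "\<And>w. w \<in> W - I \<Longrightarrow> w \<in> S \<Longrightarrow> x \<le> pot W own w \<Longrightarrow> \<not> untouched E I w \<Longrightarrow>
           pot (W - I) own' w < pot W own w"
proof -
  have fW: "finite W" using g guided_finite by blast
  obtain F where p: "picks E W own x I F" and FD: "F \<subseteq> D"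
    and drop: "\<forall>w\<in>S - I. x \<le> pot W own w \<longrightarrow> (\<exists>v\<in>I. {w, v} \<in> E) \<longrightarrow>
             (\<exists>v\<in>I. {w, v} \<in> E \<and> (w, v) \<notin> F)"
    using I unfolding guarded_def by (elim exE conjE)
  have IW: "I \<subseteq> W" and F: "F \<subseteq> (W - I) \<times> I" using p by (auto simp: picks_def)
  have fI: "finite I" using IW fW finite_subset by blast
  define own' where "own' = credit own F"
  let ?N = "\<lambda>w. {v \<in> I. {w, v} \<in> E \<and> (w, v) \<notin> F}"
  have c: "pot (W - I) own' w + card (?N w) = pot W own w" if "w \<in> W - I" for w
    using potential_credit[OF fW p that] by (simp add: own'_def)
  have gd: "guided (W - I) own'"
    unfolding guided_def
  proof (intro conjI ballI)
    show "W - I \<subseteq> V" using g by (auto simp: guided_def)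
    fix w assume w: "w \<in> W - I"
    have "card {v. (w, v) \<in> F} + card {u \<in> W - I. (w, u) \<in> D}
        = card ({v. (w, v) \<in> F} \<union> {u \<in> W - I. (w, u) \<in> D})"
      using F fI fW by (intro card_Un_disjoint[symmetric]) (auto intro: finite_subset[of _ I])
    also have "\<dots> \<le> card {u \<in> W. (w, u) \<in> D}"
      using F FD IW fW by (intro card_mono) auto
    finally show "own' w + card {u \<in> W - I. (w, u) \<in> D} \<le> k"
      using g w by (auto simp: guided_def own'_def credit_def dest!: bspec[of _ _ w])
  qed
  show thesis
  proof (rule that[of own'])
    show "step x W own (W - I) own'"
      unfolding step_def
    proof (intro conjI ballI impI gd)
      show "W - I \<subseteq> W" by blast
      fix w assume "w \<in> W - I"
      from c[OF this] show "pot (W - I) own' w \<le> pot W own w" by linarith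
    next
      assume "completable E (W - I) own' (x - 1)"
      then show "completable E W own x"
        using completable_picks[OF fW p _ \<open>0 < x\<close>] by (simp add: own'_def)
    qed
  next
    fix w assume w: "w \<in> W - I"
    have "I \<inter> in_nbrs W w \<subseteq> ?N w"
      using FD arc_edge arc_asym by (auto simp: in_nbrs_def insert_commute)
    then have "card (I \<inter> in_nbrs W w) \<le> card (?N w)" using fI by (intro card_mono) auto
    then show "pot (W - I) own' w + card (I \<inter> in_nbrs W w) \<le> pot W own w"
      using c[OF w] by linarith
  next
    fix w assume w: "w \<in> W - I" "w \<in> S" "x \<le> pot W own w" "\<not> untouched E I w"
    then have "\<exists>v\<in>I. {w, v} \<in> E \<and> (w, v) \<notin> F" using drop by (auto simp: untouched_def)
    then have "0 < card (?N w)" using fI by (auto simp: card_gt_0_iff)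
    then show "pot (W - I) own' w < pot W own w" using c[OF w(1)] by linarith
  qed
qed

text \<open>No vertex needs to drop here, so that every in-neighbour is safe. As $x \geq k$, the in-neighbours
suffice for the surplus, and no vertex of the independent set \<open>P\<close> is refused.\<close>

lemma level_all:
  assumes g: "guided W own" and P: "indep P" and x: "k \<le> x" "0 < x"
  obtains W' own' where "step x W own W' own'" "\<And>w. w \<in> W' \<Longrightarrow> w \<in> P \<Longrightarrow> pot W' own' w < x"
proof -
  obtain J where J: "guarded E D W own x {} J" and JP: "J \<subseteq> {} \<union> W \<inter> P"
    and mx: "settled W own x {} (W \<inter> P) J"
    using settled_extension[OF g guarded_empty, of "W \<inter> P" x "{}"] by blast
  obtain own' where s: "step x W own (W - J) own'"
    using step_of_guarded[OF g J x(2)] by blast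
  show thesis
  proof (rule that[OF s])
    fix w assume w: "w \<in> W - J" "w \<in> P"
    have "untouched E J w" using w JP P by (auto simp: untouched_def indep_def)
    then have "pot W own w < x"
      using mx w pot_le_in_nbrs[OF g, of w] x(1) unfolding settled_def by fastforce
    moreover have "pot (W - J) own' w \<le> pot W own w" using s w by (auto simp: step_def)
    ultimately show "pot (W - J) own' w < x" by linarith
  qed
qed

text \<open>The picking is done in three stages: first in \<open>X\<close>, then in \<open>Y\<close>, then in \<open>S\<close>. A vertex \<open>w\<close> of \<open>X\<close> with
potential \<open>x + 1\<close> that the first stage refuses has only unsafe in-neighbours. They belong to \<open>Y\<close> and
have potential exactly \<open>x\<close>, hence no surplus, and none of their neighbours has been picked, so that
the second stage takes all of them. Then \<open>w\<close> loses all its in-neighbours, and its potential drops to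
\<open>k\<close> or less.\<close>

lemma level_resolve:
  assumes g: "guided W own" and ind: "indep X" "indep Y" and x: "k + 1 \<le> x" and S: "S \<subseteq> W"
    and hi: "\<And>v. v \<in> S \<Longrightarrow> v \<in> X \<Longrightarrow> pot W own v \<le> x + 1"
    and lo: "\<And>v. v \<in> S \<Longrightarrow> v \<notin> X \<Longrightarrow> pot W own v \<le> x"
    and into: "\<And>v w. v \<in> S \<Longrightarrow> v \<in> X \<Longrightarrow> pot W own v = x + 1 \<Longrightarrow> w \<in> S \<Longrightarrow> w \<in> in_nbrs W v \<Longrightarrow> w \<in> Y"
  obtains W' own' where "step x W own W' own'" "\<And>w. w \<in> W' \<Longrightarrow> w \<in> S \<Longrightarrow> pot W' own' w < x"
proof -
  have SX: "S \<inter> X \<subseteq> W" and SY: "S \<inter> Y \<subseteq> W" and x0: "0 < x" using S x by auto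
  let ?bad = "\<lambda>J w. w \<in> S \<and> x \<le> pot W own w \<and> untouched E J w"
  obtain I1 where g1: "guarded E D W own x S I1" and I1: "I1 \<subseteq> S \<inter> X"
    and mx1: "settled W own x S (S \<inter> X) I1"
    using settled_extension[OF g guarded_empty[of E D W own x S], of "S \<inter> X"] SX SY S by auto
  obtain I2 where g2: "guarded E D W own x S I2" and I12: "I1 \<subseteq> I2" and I2: "I2 \<subseteq> I1 \<union> S \<inter> Y"
    and mx2: "settled W own x S (S \<inter> Y) I2"
    using settled_extension[OF g g1, of "S \<inter> Y"] SX SY S by auto
  obtain I where gI: "guarded E D W own x S I" and I23: "I2 \<subseteq> I"
    and mx3: "settled W own x S S I"
    using settled_extension[OF g g2, of S] SX SY S by auto
  obtain own' where s: "step x W own (W - I) own'"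
    and dr: "\<And>w. w \<in> W - I \<Longrightarrow> pot (W - I) own' w + card (I \<inter> in_nbrs W w) \<le> pot W own w"
    and dr1: "\<And>w. w \<in> W - I \<Longrightarrow> w \<in> S \<Longrightarrow> x \<le> pot W own w \<Longrightarrow> \<not> untouched E I w \<Longrightarrow>
           pot (W - I) own' w < pot W own w"
    using step_of_guarded[OF g gI x0] by blast
  show thesis
  proof (rule that[OF s])
    fix w assume w: "w \<in> W - I" "w \<in> S"
    have le: "pot (W - I) own' w \<le> pot W own w" using s w by (auto simp: step_def)
    consider "pot W own w < x" | "pot W own w = x" | "w \<in> X" "pot W own w = x + 1"
      using hi lo w by (metis Suc_eq_plus1 le_Suc_eq linorder_neqE_nat not_le)
    then show "pot (W - I) own' w < x"
    proof cases
      case 1 then show ?thesis using le by linarith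
    next
      case 2
      have "\<not> untouched E I w" using settledD(1)[OF mx3 g w(2)] S w 2 by auto
      then show ?thesis using dr1[of w] w 2 by auto
    next
      case 3
      have f1: "untouched E I1 w" using I1 3 ind w by (auto simp: untouched_def indep_def)
      have bad: "?bad I1 u" if "u \<in> in_nbrs W w" for u
        using settledD(2)[OF mx1 g, of w u] w 3 f1 I12 I23 that by auto
      have sub: "in_nbrs W w \<subseteq> I"
      proof
        fix u assume u: "u \<in> in_nbrs W w"
        have uY: "u \<in> Y" using into[of w u] bad[OF u] u w 3 by blast
        have "u \<notin> X" using ind(1) u 3 arc_edge by (auto simp: in_nbrs_def indep_def)
        then have "pot W own u = x" using lo[of u] bad[OF u] by auto
        moreover have "untouched E I2 u"
          using bad[OF u] I2 uY ind(2) unfolding untouched_def indep_def by blast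
        ultimately have "u \<in> I2" using settledD(1)[OF mx2 g, of u] bad[OF u] uY S by fastforce
        then show "u \<in> I" using I23 by blast
      qed
      then have "I \<inter> in_nbrs W w = in_nbrs W w" by blast
      then show ?thesis using dr[OF w(1)] pot_le_in_nbrs[OF g, of w] w 3 x by simp
    qed
  qed
qed

text \<open>The vertices that violate the claim are refused; their in-neighbours are unsafe, hence violate the
claim as well, and there are at least three of them because the potential is \<open>x + 1\<close>, at least \<open>k + 3\<close>.\<close>

lemma potential_high_touched:
  assumes g: "guided W own" and x: "k + 2 \<le> x" and hi: "\<And>v. v \<in> W \<Longrightarrow> pot W own v \<le> x + 1"
    and mx: "settled W own x W W I"
    and w: "w \<in> W" "w \<notin> I" "x \<le> pot W own w"
  shows "\<not> untouched E I w"
proof -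
  define T where "T = {v \<in> W. v \<notin> I \<and> x \<le> pot W own v \<and> untouched E I v}"
  have "T = {}"
  proof (rule no_closed_set[of _ W])
    show "T \<subseteq> V" using g by (auto simp: T_def guided_def)
    fix v assume v: "v \<in> T"
    then have vW: "v \<in> W" and vf: "untouched E I v" by (auto simp: T_def)
    note r = settledD[OF mx g vW vW _ vf _ hi[OF vW]]
    have "u \<notin> I" if "u \<in> in_nbrs W v" for u
      using that vf arc_edge by (auto simp: in_nbrs_def untouched_def insert_commute)
    then have "in_nbrs W v \<subseteq> T" using r(2) v by (auto simp: T_def)
    then show "in_nbrs W v \<subseteq> T \<and> 3 \<le> card (in_nbrs W v)"
      using pot_le_in_nbrs[OF g vW] r(1) v x by (simp add: T_def)
  qed
  then show ?thesis using w by (auto simp: T_def)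
qed

text \<open>Again the stages are \<open>X\<close>, \<open>Y\<close> and \<open>W\<close>. If \<open>w\<close> in \<open>X\<close> has potential \<open>x\<close> afterwards, then the first stage
refused it at potential \<open>x + 1\<close>, so its in-neighbours are unsafe; those in \<open>Y\<close> have potential
exactly \<open>x\<close> and are taken by the second stage.\<close>

lemma level_clean:
  assumes g: "guided W own" and ind: "indep X" "indep Y" and x: "k + 2 \<le> x"
    and hi: "\<And>v. v \<in> W \<Longrightarrow> pot W own v \<le> x + 1"
    and lo: "\<And>v. v \<in> W \<Longrightarrow> v \<in> Y \<Longrightarrow> pot W own v \<le> x"
  obtains W' own' where "step x W own W' own'" "\<And>w. w \<in> W' \<Longrightarrow> pot W' own' w \<le> x"
    "\<And>w. w \<in> W' \<Longrightarrow> pot W' own' w = x \<Longrightarrow> pot W own w = x + 1"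
    "\<And>w u. w \<in> W' \<Longrightarrow> w \<in> X \<Longrightarrow> pot W' own' w = x \<Longrightarrow> u \<in> in_nbrs W' w \<Longrightarrow> u \<notin> Y"
proof -
  have x0: "0 < x" using x by simp
  let ?bad = "\<lambda>J w. w \<in> W \<and> x \<le> pot W own w \<and> untouched E J w"
  obtain I1 where g1: "guarded E D W own x W I1" and I1: "I1 \<subseteq> W \<inter> X"
    and mx1: "settled W own x W (W \<inter> X) I1"
    using settled_extension[OF g guarded_empty[of E D W own x W], of "W \<inter> X"] by auto
  obtain I2 where g2: "guarded E D W own x W I2" and I12: "I1 \<subseteq> I2" and I2: "I2 \<subseteq> I1 \<union> W \<inter> Y"
    and mx2: "settled W own x W (W \<inter> Y) I2"
    using settled_extension[OF g g1, of "W \<inter> Y"] by auto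
  obtain I where gI: "guarded E D W own x W I" and I23: "I2 \<subseteq> I"
    and mx3: "settled W own x W W I"
    using settled_extension[OF g g2, of W] by auto
  have nf: "\<not> untouched E I w" if "w \<in> W - I" "x \<le> pot W own w" for w
    using potential_high_touched[OF g x hi mx3] that by blast
  obtain own' where s: "step x W own (W - I) own'"
    and "\<And>w. w \<in> W - I \<Longrightarrow> pot (W - I) own' w + card (I \<inter> in_nbrs W w) \<le> pot W own w"
    and dr1: "\<And>w. w \<in> W - I \<Longrightarrow> w \<in> W \<Longrightarrow> x \<le> pot W own w \<Longrightarrow> \<not> untouched E I w \<Longrightarrow>
           pot (W - I) own' w < pot W own w"
    using step_of_guarded[OF g gI x0] by blast
  have le: "pot (W - I) own' w \<le> pot W own w" if "w \<in> W - I" for w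
    using s that by (auto simp: step_def)
  show thesis
  proof (rule that[OF s])
    fix w assume w: "w \<in> W - I"
    show "pot (W - I) own' w \<le> x"
      using le[OF w] dr1[OF w] nf[OF w] hi[of w] w by fastforce
    show flex: "pot W own w = x + 1" if "pot (W - I) own' w = x"
      using le[OF w] dr1[OF w] nf[OF w] hi[of w] w that by fastforce
    fix u assume wX: "w \<in> X" and c: "pot (W - I) own' w = x" and u: "u \<in> in_nbrs (W - I) w"
    show "u \<notin> Y"
    proof
      assume uY: "u \<in> Y"
      have f1: "untouched E I1 w" using I1 wX ind by (auto simp: untouched_def indep_def)
      have uW: "u \<in> in_nbrs W w" "u \<in> W" "u \<notin> I" using u by (auto simp: in_nbrs_def)
      have bad: "?bad I1 u"
        using settledD(2)[OF mx1 g, of w u] w wX flex[OF c] f1 I12 I23 uW by auto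
      have "untouched E I2 u"
        using bad I2 uY ind(2) unfolding untouched_def indep_def by blast
      then show False using settledD(1)[OF mx2 g, of u] bad uY uW lo[of u] I23 by fastforce
    qed
  qed
qed

text \<open>The in-neighbours of a vertex that the first stage refuses in \<open>X\<close> lie in \<open>Y\<close>, and those of a vertex that
the second stage refuses in \<open>Y\<close> lie in \<open>X\<close> and have been refused before. If an in-neighbour of a
refused vertex of \<open>X\<close> were not picked, it would itself be refused, so the vertices that both stages
leave untouched would form a set closed under in-neighbours, and such a set is empty.\<close>

lemma level_bipartite:
  assumes g: "guided W own" and ind: "indep X" "indep Y" and x: "k + 2 \<le> x"
    and hi: "\<And>v. v \<in> W \<Longrightarrow> pot W own v \<le> x + 1"
    and intoX: "\<And>v w. v \<in> W \<Longrightarrow> v \<in> X \<Longrightarrow> pot W own v = x + 1 \<Longrightarrow> w \<in> in_nbrs W v \<Longrightarrow> w \<in> Y"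
    and intoY: "\<And>v w. v \<in> W \<Longrightarrow> v \<in> Y \<Longrightarrow> pot W own v = x + 1 \<Longrightarrow> w \<in> in_nbrs W v \<Longrightarrow> w \<in> X"
  obtains W' own' where "step x W own W' own'" "\<And>w. w \<in> W' \<Longrightarrow> pot W' own' w \<le> x"
    "\<And>w. w \<in> W' \<Longrightarrow> pot W' own' w = x \<Longrightarrow> pot W own w = x + 1"
    "\<And>w. w \<in> W' \<Longrightarrow> w \<in> X \<Longrightarrow> pot W' own' w < x"
proof -
  have x0: "0 < x" using x by simp
  let ?bad = "\<lambda>J w. w \<in> W \<and> x \<le> pot W own w \<and> untouched E J w"
  obtain I1 where g1: "guarded E D W own x W I1" and I1: "I1 \<subseteq> W \<inter> X"
    and mx1: "settled W own x W (W \<inter> X) I1"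
    using settled_extension[OF g guarded_empty[of E D W own x W], of "W \<inter> X"] by auto
  obtain I2 where g2: "guarded E D W own x W I2" and I12: "I1 \<subseteq> I2" and I2: "I2 \<subseteq> I1 \<union> W \<inter> Y"
    and mx2: "settled W own x W (W \<inter> Y) I2"
    using settled_extension[OF g g1, of "W \<inter> Y"] by auto
  obtain I where gI: "guarded E D W own x W I" and I23: "I2 \<subseteq> I"
    and mx3: "settled W own x W W I"
    using settled_extension[OF g g2, of W] by auto
  have nf: "\<not> untouched E I w" if "w \<in> W - I" "x \<le> pot W own w" for w
    using potential_high_touched[OF g x hi mx3] that by blast
  obtain own' where s: "step x W own (W - I) own'"
    and dr: "\<And>w. w \<in> W - I \<Longrightarrow> pot (W - I) own' w + card (I \<inter> in_nbrs W w) \<le> pot W own w"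
    and dr1: "\<And>w. w \<in> W - I \<Longrightarrow> w \<in> W \<Longrightarrow> x \<le> pot W own w \<Longrightarrow> \<not> untouched E I w \<Longrightarrow>
           pot (W - I) own' w < pot W own w"
    using step_of_guarded[OF g gI x0] by blast
  have le: "pot (W - I) own' w \<le> pot W own w" if "w \<in> W - I" for w
    using s that by (auto simp: step_def)
  have I1X: "I1 \<subseteq> X" using I1 by blast
  have freeX: "untouched E I1 w" if "w \<in> X" for w
    using I1X ind(1) that by (auto simp: untouched_def indep_def)
  have rejX: "pot W own w = x + 1 \<and> (\<forall>u\<in>in_nbrs W w. ?bad I1 u \<and> u \<in> Y)"
    if "w \<in> W" "w \<in> X" "w \<notin> I1" "x \<le> pot W own w" for w
  proof -
    note r = settledD[OF mx1 g _ that(1,3) freeX[OF that(2)] that(4) hi[OF that(1)]]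
    have "w \<in> W \<inter> X" using that by blast
    note r = r[OF this]
    show ?thesis using r intoX[OF that(1,2) r(1)] by blast
  qed
  have freeY: "untouched E I2 u" if "untouched E I1 u" "u \<in> Y" for u
    using that I2 ind(2) unfolding untouched_def indep_def by blast
  define T where "T = {w \<in> W. x \<le> pot W own w \<and> w \<notin> I2 \<and> untouched E I2 w \<and> w \<in> X \<union> Y}"
  have "T = {}"
  proof (rule no_closed_set[of _ W])
    show "T \<subseteq> V" using g by (auto simp: T_def guided_def)
    fix v assume "v \<in> T"
    then have v: "v \<in> W" "x \<le> pot W own v" "v \<notin> I2" "untouched E I2 v" "v \<in> X \<union> Y"
      by (auto simp: T_def)
    have nI2: "u \<notin> I2" if "u \<in> in_nbrs W v" for u
      using that v(4) arc_edge by (auto simp: in_nbrs_def untouched_def insert_commute)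
    have "pot W own v = x + 1 \<and> in_nbrs W v \<subseteq> T"
    proof (cases "v \<in> X")
      case True
      have r: "pot W own v = x + 1" "\<forall>u\<in>in_nbrs W v. ?bad I1 u \<and> u \<in> Y"
        using rejX[of v] v True I12 by blast+
      have "u \<in> T" if "u \<in> in_nbrs W v" for u
        using r(2) that nI2[OF that] freeY[of u] by (auto simp: T_def)
      then show ?thesis using r(1) by blast
    next
      case False
      then have vY: "v \<in> Y" using v by blast
      have "v \<in> W \<inter> Y" using v vY by blast
      note r = settledD[OF mx2 g this v(1,3,4,2) hi[OF v(1)]]
      have "u \<in> T" if "u \<in> in_nbrs W v" for u
        using r(2)[OF that] nI2[OF that] intoY[OF v(1) vY r(1) that] by (auto simp: T_def)
      then show ?thesis using r(1) by blast
    qed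
    then show "in_nbrs W v \<subseteq> T \<and> 3 \<le> card (in_nbrs W v)"
      using pot_le_in_nbrs[OF g v(1)] x by auto
  qed
  then have noT: False if "w \<in> W" "x \<le> pot W own w" "w \<notin> I2" "untouched E I2 w" "w \<in> X \<union> Y" for w
    using that by (auto simp: T_def)
  show thesis
  proof (rule that[OF s])
    fix w assume w: "w \<in> W - I"
    show "pot (W - I) own' w \<le> x"
      using le[OF w] dr1[OF w] nf[OF w] hi[of w] w by fastforce
    show "pot W own w = x + 1" if "pot (W - I) own' w = x"
      using le[OF w] dr1[OF w] nf[OF w] hi[of w] w that by fastforce
    assume wX: "w \<in> X"
    show "pot (W - I) own' w < x"
    proof (cases "x \<le> pot W own w")
      case False then show ?thesis using le[OF w] by linarith
    next
      case True
      have r: "pot W own w = x + 1" "\<forall>u\<in>in_nbrs W w. ?bad I1 u \<and> u \<in> Y"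
        using rejX[of w] w wX True I12 I23 by blast+
      have "u \<in> I" if "u \<in> in_nbrs W w" for u
        using noT[of u] r(2) that freeY[of u] I23 by blast
      then have "I \<inter> in_nbrs W w = in_nbrs W w" by blast
      then show ?thesis using dr[OF w] pot_le_in_nbrs[OF g, of w] w r(1) x by simp
    qed
  qed
qed

lemma stepD:
  assumes "step x W own W' own'"
  shows "guided W' own'" "W' \<subseteq> W" "w \<in> W' \<Longrightarrow> pot W' own' w \<le> pot W own w"
    "completable E W' own' (x - 1) \<Longrightarrow> completable E W own x" "in_nbrs W' w \<subseteq> in_nbrs W w"
  using assms by (auto simp: step_def in_nbrs_def)

lemma in_nbrs_indep: "indep X \<Longrightarrow> v \<in> X \<Longrightarrow> w \<in> in_nbrs W v \<Longrightarrow> w \<notin> X"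
  using arc_edge by (auto simp: indep_def in_nbrs_def)

text \<open>After the round at \<open>k + 6\<close> the classes \<open>B\<close> and \<open>C\<close> have potential at most \<open>k + 5\<close>, and after the next one
\<open>A\<close> has potential at most \<open>k + 4\<close>. From then on \<open>A\<close> is one ahead. The rounds at \<open>k + 4\<close> and \<open>k + 3\<close> use
this lead: they leave no arc from \<open>A\<close> into a vertex of highest potential in \<open>C\<close> and in \<open>B\<close>. The arcs
into such vertices then run between \<open>B\<close> and \<open>C\<close>, which is what the last two rounds need.\<close>

theorem completable_three_classes:
  assumes g0: "guided V (\<lambda>_. 0)" and ind: "indep A" "indep B" "indep C"
    and cover: "V \<subseteq> A \<union> B \<union> C" and disj: "A \<inter> B = {}" "A \<inter> C = {}" "B \<inter> C = {}"
  shows "completable E V (\<lambda>_. 0) (k + 8)"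
proof -
  obtain W1 o1 where s1: "step (k + 8) V (\<lambda>_. 0) W1 o1"
    and C1: "\<And>w. w \<in> W1 \<Longrightarrow> w \<in> C \<Longrightarrow> pot W1 o1 w < k + 8"
    using level_all[OF g0 ind(3), of "k + 8"] by auto
  note d1 = stepD[OF s1]
  obtain W2 o2 where s2: "step (k + 7) W1 o1 W2 o2"
    and B2: "\<And>w. w \<in> W2 \<Longrightarrow> w \<in> B \<Longrightarrow> pot W2 o2 w < k + 7"
    using level_all[OF d1(1) ind(2), of "k + 7"] by auto
  note d2 = stepD[OF s2]
  have C2: "pot W2 o2 w \<le> k + 7" if "w \<in> W2" "w \<in> C" for w
    using C1[of w] d2(2) d2(3)[OF that(1)] that by fastforce
  obtain W3 o3 where s3: "step (k + 6) W2 o2 W3 o3"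
    and S3: "\<And>w. w \<in> W3 \<Longrightarrow> w \<in> W2 \<inter> (B \<union> C) \<Longrightarrow> pot W3 o3 w < k + 6"
  proof (rule level_resolve[OF d2(1) ind(3,2), of "k + 6" "W2 \<inter> (B \<union> C)"])
    fix v assume "v \<in> W2 \<inter> (B \<union> C)" "v \<in> C"
    then show "pot W2 o2 v \<le> k + 6 + 1" using C2[of v] by simp
  next
    fix v assume "v \<in> W2 \<inter> (B \<union> C)" "v \<notin> C"
    then show "pot W2 o2 v \<le> k + 6" using B2[of v] by auto
  next
    fix v w assume "v \<in> C" "w \<in> W2 \<inter> (B \<union> C)" "w \<in> in_nbrs W2 v"
    then show "w \<in> B" using in_nbrs_indep[OF ind(3)] by blast
  qed auto
  note d3 = stepD[OF s3]
  have BC3: "pot W3 o3 w \<le> k + 5" if "w \<in> W3" "w \<in> B \<union> C" for w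
    using S3[of w] d3(2) that by auto
  obtain W4 o4 where s4: "step (k + 5) W3 o3 W4 o4"
    and A4: "\<And>w. w \<in> W4 \<Longrightarrow> w \<in> A \<Longrightarrow> pot W4 o4 w < k + 5"
    using level_all[OF d3(1) ind(1), of "k + 5"] by auto
  note d4 = stepD[OF s4]
  have sub4: "W4 \<subseteq> A \<union> B \<union> C" using d1(2) d2(2) d3(2) d4(2) cover by blast
  have all4: "pot W4 o4 w \<le> k + 5" if w: "w \<in> W4" for w
  proof (cases "w \<in> A")
    case True then show ?thesis using A4[OF w] by simp
  next
    case False
    then have "w \<in> W3" "w \<in> B \<union> C" using w sub4 d4(2) by auto
    then show ?thesis using BC3[of w] d4(3)[OF w] by linarith
  qed
  \<comment> \<open>The vertices of $A$ start this round at least one below the others, and only vertices that were at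
    $k + 5$ can end it at $k + 4$; this keeps $A$ ahead.\<close>
  obtain W5 o5 where s5: "step (k + 4) W4 o4 W5 o5"
    and all5: "\<And>w. w \<in> W5 \<Longrightarrow> pot W5 o5 w \<le> k + 4"
    and flex5: "\<And>w. w \<in> W5 \<Longrightarrow> pot W5 o5 w = k + 4 \<Longrightarrow> pot W4 o4 w = k + 4 + 1"
    and C5: "\<And>w u. w \<in> W5 \<Longrightarrow> w \<in> C \<Longrightarrow> pot W5 o5 w = k + 4 \<Longrightarrow> u \<in> in_nbrs W5 w \<Longrightarrow> u \<notin> A"
  proof (rule level_clean[OF d4(1) ind(3,1), of "k + 4"])
    fix v assume "v \<in> W4" then show "pot W4 o4 v \<le> k + 4 + 1" using all4[of v] by simp
  next
    fix v assume "v \<in> W4" "v \<in> A" then show "pot W4 o4 v \<le> k + 4" using A4[of v] by simp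
  qed auto
  note d5 = stepD[OF s5]
  have A5: "pot W5 o5 w \<le> k + 3" if "w \<in> W5" "w \<in> A" for w
    using all5[OF that(1)] flex5[OF that(1)] A4[of w] d5(2) that by fastforce
  obtain W6 o6 where s6: "step (k + 3) W5 o5 W6 o6"
    and all6: "\<And>w. w \<in> W6 \<Longrightarrow> pot W6 o6 w \<le> k + 3"
    and flex6: "\<And>w. w \<in> W6 \<Longrightarrow> pot W6 o6 w = k + 3 \<Longrightarrow> pot W5 o5 w = k + 3 + 1"
    and B6: "\<And>w u. w \<in> W6 \<Longrightarrow> w \<in> B \<Longrightarrow> pot W6 o6 w = k + 3 \<Longrightarrow> u \<in> in_nbrs W6 w \<Longrightarrow> u \<notin> A"
  proof (rule level_clean[OF d5(1) ind(2,1), of "k + 3"])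
    fix v assume "v \<in> W5" then show "pot W5 o5 v \<le> k + 3 + 1" using all5[of v] by simp
  next
    fix v assume "v \<in> W5" "v \<in> A" then show "pot W5 o5 v \<le> k + 3" using A5[of v] by simp
  qed auto
  note d6 = stepD[OF s6]
  have sub6: "W6 \<subseteq> A \<union> B \<union> C" using sub4 d5(2) d6(2) by blast
  have C6: "u \<notin> A" if "w \<in> W6" "w \<in> C" "pot W6 o6 w = k + 3" "u \<in> in_nbrs W6 w" for w u
    using C5[of w u] flex6[OF that(1,3)] d6(2) d6(5)[of w] that by auto
  have inn6: "w \<in> A \<union> B \<union> C" if "w \<in> in_nbrs W6 v" for v w
    using that sub6 by (auto simp: in_nbrs_def)
  obtain W7 o7 where s7: "step (k + 2) W6 o6 W7 o7"
    and all7: "\<And>w. w \<in> W7 \<Longrightarrow> pot W7 o7 w \<le> k + 2"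
    and flex7: "\<And>w. w \<in> W7 \<Longrightarrow> pot W7 o7 w = k + 2 \<Longrightarrow> pot W6 o6 w = k + 2 + 1"
    and C7: "\<And>w. w \<in> W7 \<Longrightarrow> w \<in> C \<Longrightarrow> pot W7 o7 w < k + 2"
  proof (rule level_bipartite[OF d6(1) ind(3,2), of "k + 2"])
    fix v assume "v \<in> W6" then show "pot W6 o6 v \<le> k + 2 + 1" using all6[of v] by simp
  next
    fix v w assume "v \<in> W6" "v \<in> C" "pot W6 o6 v = k + 2 + 1" "w \<in> in_nbrs W6 v"
    then show "w \<in> B" using C6[of v w] in_nbrs_indep[OF ind(3), of v w] inn6[of w v] by auto
  next
    fix v w assume "v \<in> W6" "v \<in> B" "pot W6 o6 v = k + 2 + 1" "w \<in> in_nbrs W6 v"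
    then show "w \<in> C" using B6[of v w] in_nbrs_indep[OF ind(2), of v w] inn6[of w v] by auto
  qed auto
  note d7 = stepD[OF s7]
  have B7: "u \<in> C" if "w \<in> W7" "w \<in> B" "pot W7 o7 w = k + 2" "u \<in> in_nbrs W7 w" for w u
    using B6[of w u] flex7[OF that(1,3)] d7(2) d7(5)[of w] in_nbrs_indep[OF ind(2), of w u] inn6[of u w] that
    by auto
  have A7: "pot W7 o7 w \<le> k + 1" if w: "w \<in> W7" "w \<in> A" for w
  proof (rule ccontr)
    assume "\<not> ?thesis"
    then have "pot W6 o6 w = k + 3" using all7[OF w(1)] flex7[OF w(1)] by simp
    then have "pot W5 o5 w = k + 4" using flex6[of w] w d7(2) by auto
    then show False using A5[of w] w d7(2) d6(2) by fastforce
  qed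
  obtain W8 o8 where s8: "step (k + 1) W7 o7 W8 o8"
    and all8: "\<And>w. w \<in> W8 \<Longrightarrow> w \<in> W7 \<Longrightarrow> pot W8 o8 w < k + 1"
  proof (rule level_resolve[OF d7(1) ind(2,3), of "k + 1" W7])
    fix v assume "v \<in> W7" then show "pot W7 o7 v \<le> k + 1 + 1" using all7[of v] by simp
  next
    fix v assume v: "v \<in> W7" "v \<notin> B"
    then have "v \<in> A \<union> C" using sub6 d7(2) by auto
    then show "pot W7 o7 v \<le> k + 1" using A7[of v] C7[of v] v by auto
  next
    fix v w assume "v \<in> W7" "v \<in> B" "pot W7 o7 v = k + 1 + 1" "w \<in> in_nbrs W7 v"
    then show "w \<in> C" using B7[of v w] by simp
  qed auto
  note d8 = stepD[OF s8]
  have "completable E W8 o8 k"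
    using all8 d8(2) by (intro completable_flat guided_finite[OF d8(1)] loop) force+
  then have "completable E W7 o7 (k + 1)" using d8(4) by (metis add_diff_cancel_right')
  then have "completable E W6 o6 (k + 2)" by (intro d7(4)) (simp add: eval_nat_numeral)
  then have "completable E W5 o5 (k + 3)" by (intro d6(4)) (simp add: eval_nat_numeral)
  then have "completable E W4 o4 (k + 4)" by (intro d5(4)) (simp add: eval_nat_numeral)
  then have "completable E W3 o3 (k + 5)" by (intro d4(4)) (simp add: eval_nat_numeral)
  then have "completable E W2 o2 (k + 6)" by (intro d3(4)) (simp add: eval_nat_numeral)
  then have "completable E W1 o1 (k + 7)" by (intro d2(4)) (simp add: eval_nat_numeral)
  then show ?thesis by (intro d1(4)) (simp add: eval_nat_numeral)
qed

end

section \<open>From sparsity to the proper orientation number\<close>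

text \<open>The density bound provides the guiding orientation, the bound $3|X|$ excludes stuck configurations, and
the colour classes are the three independent sets.\<close>

theorem proper_orientation_number_le:
  assumes G: "simple_graph V E" and col: "colorable 3 V E"
    and dense: "\<And>X. X \<subseteq> V \<Longrightarrow> card {e \<in> E. e \<subseteq> X} \<le> k * card X"
    and sparse: "\<And>X. X \<subseteq> V \<Longrightarrow> X \<noteq> {} \<Longrightarrow> card {e \<in> E. e \<subseteq> X} < 3 * card X"
  shows "proper_orientation_number V E \<le> k + 8"
proof -
  note finV = graph_finite(1)[OF G] and finE = graph_finite(2)[OF G]
  have "\<exists>D. orientation E D \<and> (\<forall>v\<in>V. outdeg D v \<le> k)"
  proof (rule bounded_orientation[OF G])
    fix X assume "X \<subseteq> V"
    then show "card {e \<in> E. e \<subseteq> X} \<le> (\<Sum>v\<in>X. k)" using dense[of X] by (simp add: mult.commute)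
  qed
  then obtain D where D: "orientation E D" and out: "\<And>v. v \<in> V \<Longrightarrow> outdeg D v \<le> k" by blast
  interpret guided_graph V E D k
  proof
    show "finite V" by fact
    show "{v} \<notin> E" for v using graph_no_loop[OF G] .
    show "{u, v} \<in> E" if "(u, v) \<in> D" for u v using D that by (auto simp: orientation_def)
    show arcs: "(u, v) \<in> D \<longleftrightarrow> (v, u) \<notin> D" if "{u, v} \<in> E" for u v
      using D that by (simp add: orientation_def)
    fix T assume T: "T \<subseteq> V" "T \<noteq> {}"
    have "inj_on (\<lambda>(u, v). {u, v}) (D \<inter> T \<times> T)"
    proof (rule inj_onI, clarify)
      fix u v u' v' assume a: "(u, v) \<in> D" "(u', v') \<in> D" "{u, v} = {u', v'}"
      have "{u, v} \<in> E" using D a by (auto simp: orientation_def)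
      then have "(v, u) \<notin> D" using arcs[of u v] a by blast
      then show "u = u' \<and> v = v'" using a by (auto simp: doubleton_eq_iff)
    qed
    then have "card (D \<inter> T \<times> T) = card ((\<lambda>(u, v). {u, v}) ` (D \<inter> T \<times> T))" by (simp add: card_image)
    also have "\<dots> \<le> card {e \<in> E. e \<subseteq> T}"
      using D finE by (intro card_mono) (auto simp: orientation_def)
    also have "\<dots> < 3 * card T" using sparse T by blast
    finally show "card (D \<inter> T \<times> T) < 3 * card T" .
  qed
  obtain c :: "'a \<Rightarrow> nat" where c: "\<And>v. v \<in> V \<Longrightarrow> c v < 3" "\<And>u v. {u, v} \<in> E \<Longrightarrow> c u \<noteq> c v"
    using col by (auto simp: colorable_def)
  have "completable E V (\<lambda>_. 0) (k + 8)"
  proof (rule completable_three_classes)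
    have "card {u \<in> V. (v, u) \<in> D} \<le> k" if "v \<in> V" for v
    proof -
      have "{u \<in> V. (v, u) \<in> D} = {u. (v, u) \<in> D}"
        using graph_vertex[OF G] arc_edge by blast
      then show ?thesis using out[OF that] by (simp add: outdeg_def)
    qed
    then show "guided V (\<lambda>_. 0)" by (simp add: guided_def)
    show "indep {v \<in> V. c v = 0}" "indep {v \<in> V. c v = 1}" "indep {v \<in> V. c v = 2}"
      using c(2) by (fastforce simp: indep_def)+
    show "V \<subseteq> {v \<in> V. c v = 0} \<union> {v \<in> V. c v = 1} \<union> {v \<in> V. c v = 2}"
      using c(1) by fastforce
  qed auto
  moreover have "{e \<in> E. e \<subseteq> V} = E" using G by (auto simp: simple_graph_def)
  ultimately obtain A where A: "orientation E A" "\<And>v. v \<in> V \<Longrightarrow> outdeg A v \<le> k + 8"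
    "\<And>u v. u \<in> V \<Longrightarrow> v \<in> V \<Longrightarrow> {u, v} \<in> E \<Longrightarrow> outdeg A u \<noteq> outdeg A v"
    unfolding completable_def by auto
  have "proper_orientation E A"
    using A(1,3) graph_vertex[OF G] by (simp add: proper_orientation_def)
  then have "proper_orientation_number V E \<le> max_outdeg V A"
    unfolding proper_orientation_number_def by (intro Least_le) blast
  also have "\<dots> \<le> k + 8" using A(2) finV by (simp add: max_outdeg_def)
  finally show ?thesis .
qed

section \<open>Attaching an arc to a compact set in the plane\<close>

text \<open>By invariance of dimension, as an arc is homeomorphic to an interval.\<close>

lemma arc_no_interior:
  fixes g :: "real \<Rightarrow> complex"
  assumes "arc g" "open U" "U \<subseteq> path_image g"
  shows "U = {}"
proof (rule ccontr)
  assume "U \<noteq> {}"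
  obtain f where f: "homeomorphism {0..1} (path_image g) g f"
    using assms(1) homeomorphism_arc by blast
  have "continuous_on U f" using f assms(3) continuous_on_subset homeomorphism_def by blast
  moreover have "inj_on f U" using f assms(3) by (metis homeomorphism_apply2 inj_onI subsetD)
  ultimately have "DIM(complex) \<le> DIM(real)"
    using invariance_of_dimension[of U f] assms(2) \<open>U \<noteq> {}\<close> by blast
  then show False by simp
qed

lemma path_component_arc:
  fixes K :: "complex set"
  assumes "path_component K a b" "a \<noteq> b"
  obtains p where "arc p" "path_image p \<subseteq> K" "pathstart p = a" "pathfinish p = b"
proof -
  obtain q where q: "path q" "path_image q \<subseteq> K" "pathstart q = a" "pathfinish q = b"
    using assms(1) by (auto simp: path_component_def)
  have "path_connected (path_image q)" using q(1) by (rule path_connected_path_image)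
  moreover have "a \<in> path_image q" "b \<in> path_image q" using q by auto
  ultimately show thesis
    using that q(2) assms(2) unfolding path_connected_arcwise by (meson order_trans)
qed

text \<open>The arc \<open>g\<close> and a path \<open>P\<close> in \<open>K\<close> between its ends form a Jordan curve. The conclusion lists what the
Jordan curve theorem says about its inside and its outside, in a form symmetric in both.\<close>

lemma theta_cycle:
  fixes K :: "complex set"
  assumes g: "arc g" and meet: "K \<inter> path_image g = {pathstart g, pathfinish g}"
    and pc: "path_component K (pathstart g) (pathfinish g)"
  shows "\<exists>P In Out. P \<subseteq> K \<and> compact P \<and> connected P \<and> {pathstart g, pathfinish g} \<subseteq> P \<and>
    open In \<and> open Out \<and> connected In \<and> connected Out \<and>
    In \<inter> Out = {} \<and> In \<union> Out = - (P \<union> path_image g) \<and>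
    frontier In = P \<union> path_image g \<and> frontier Out = P \<union> path_image g"
proof -
  have ne: "pathfinish g \<noteq> pathstart g" using g arc_distinct_ends by fastforce
  obtain p where p: "arc p" "path_image p \<subseteq> K" "pathstart p = pathfinish g" "pathfinish p = pathstart g"
    using path_component_arc[OF path_component_sym[OF pc] ne] by blast
  have "simple_path (p +++ g)"
    using p g meet by (intro simple_path_join_loop) auto
  moreover have "pathfinish (p +++ g) = pathstart (p +++ g)" using p by simp
  moreover have "path_image (p +++ g) = path_image p \<union> path_image g"
    using p by (simp add: path_image_join)
  ultimately have J: "open (inside (path_image p \<union> path_image g))" "connected (inside (path_image p \<union> path_image g))"
    "open (outside (path_image p \<union> path_image g))" "connected (outside (path_image p \<union> path_image g))"
    "inside (path_image p \<union> path_image g) \<inter> outside (path_image p \<union> path_image g) = {}"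
    "inside (path_image p \<union> path_image g) \<union> outside (path_image p \<union> path_image g) = - (path_image p \<union> path_image g)"
    "frontier (inside (path_image p \<union> path_image g)) = path_image p \<union> path_image g"
    "frontier (outside (path_image p \<union> path_image g)) = path_image p \<union> path_image g"
    using Jordan_inside_outside[of "p +++ g"] by auto
  have "{pathstart g, pathfinish g} \<subseteq> path_image p"
    using p(3,4) pathstart_in_path_image[of p] pathfinish_in_path_image[of p] by simp
  moreover have "compact (path_image p)" "connected (path_image p)"
    using p(1) by (simp_all add: arc_imp_path compact_path_image connected_path_image)
  ultimately show ?thesis using p(2) J
    by (intro exI[of _ "path_image p"] exI[of _ "inside (path_image p \<union> path_image g)"]
        exI[of _ "outside (path_image p \<union> path_image g)"] conjI)
qed

definition open_arc :: "(real \<Rightarrow> complex) \<Rightarrow> complex set" where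
  "open_arc g = path_image g - {pathstart g, pathfinish g}"

lemma open_arc_image: "arc g \<Longrightarrow> open_arc g = g ` {0<..<1}"
proof -
  assume "arc g"
  then have inj: "inj_on g {0..1}" by (simp add: arc_def)
  have "{0..1} - {0, 1} = {0<..<(1::real)}" by auto
  then have "g ` {0<..<1} = g ` {0..1} - g ` {0, 1}"
    using inj_on_image_set_diff[OF inj, of "{0..1}" "{0, 1}"] by auto
  then show ?thesis by (simp add: open_arc_def path_image_def pathstart_def pathfinish_def)
qed

lemma open_arc_connected: "arc g \<Longrightarrow> connected (open_arc g)"
  and open_arc_nonempty: "arc g \<Longrightarrow> open_arc g \<noteq> {}"
proof -
  assume g: "arc g"
  have "continuous_on {0<..<1} g"
    using g by (auto simp: arc_def path_def intro: continuous_on_subset)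
  then show "connected (open_arc g)"
    by (simp add: open_arc_image[OF g] connected_continuous_image)
  show "open_arc g \<noteq> {}" by (simp add: open_arc_image[OF g])
qed

text \<open>Near a point of the open arc there is a disc that avoids \<open>K\<close>; it joins the set \<open>C\<close> to the arc.\<close>

lemma component_touching_arc:
  fixes K :: "complex set"
  assumes g: "arc g" and meet: "K \<inter> path_image g = {pathstart g, pathfinish g}" and K: "closed K"
    and C: "connected C" "C \<subseteq> - K" "closure C \<inter> open_arc g \<noteq> {}"
    and z: "z \<in> open_arc g"
  shows "C \<subseteq> connected_component_set (- K) z"
proof -
  obtain y where y: "y \<in> closure C" "y \<in> open_arc g" using C(3) by blast
  have sub: "open_arc g \<subseteq> - K" using meet by (auto simp: open_arc_def)
  then obtain r where r: "0 < r" "ball y r \<subseteq> - K"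
    using K y(2) by (meson open_Compl open_contains_ball subsetD)
  obtain c where c: "c \<in> C" "dist c y < r" using y(1) r(1) closure_approachable by blast
  have "connected (ball y r \<union> C)"
  proof (rule connected_Un)
    have "c \<in> ball y r \<inter> C" using c by (simp add: dist_commute)
    then show "ball y r \<inter> C \<noteq> {}" by blast
  qed (use C(1) in auto)
  then have "connected (open_arc g \<union> (ball y r \<union> C))"
  proof (rule connected_Un[OF open_arc_connected[OF g]])
    have "y \<in> open_arc g \<inter> (ball y r \<union> C)" using y(2) r(1) by simp
    then show "open_arc g \<inter> (ball y r \<union> C) \<noteq> {}" by blast
  qed
  moreover have "open_arc g \<union> (ball y r \<union> C) \<subseteq> - K" using sub r C by auto
  ultimately have "open_arc g \<union> (ball y r \<union> C) \<subseteq> connected_component_set (- K) z"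
    using z by (intro connected_component_maximal) auto
  then show ?thesis by blast
qed

text \<open>Near an inner point of the arc there are points of both sides of the Jordan curve. They are joined by
a small disc that avoids \<open>K\<close>, but not in the complement of the curve.\<close>

lemma closing_arc_separates:
  fixes K :: "complex set"
  assumes g: "arc g" and meet: "K \<inter> path_image g = {pathstart g, pathfinish g}" and K: "closed K"
    and pc: "path_component K (pathstart g) (pathfinish g)"
  obtains p q where "connected_component (- K) p q" "p \<notin> K \<union> path_image g" "q \<notin> K \<union> path_image g"
    "\<not> connected_component (- (K \<union> path_image g)) p q"
proof -
  obtain P In Out where J: "P \<subseteq> K" "compact P" "connected P" "{pathstart g, pathfinish g} \<subseteq> P"
    "open In" "open Out" "connected In" "connected Out"
    "In \<inter> Out = {}" "In \<union> Out = - (P \<union> path_image g)"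
    "frontier In = P \<union> path_image g" "frontier Out = P \<union> path_image g"
    using theta_cycle[OF g meet pc] by (elim exE conjE)
  obtain z where z: "z \<in> open_arc g" using open_arc_nonempty[OF g] by blast
  have "z \<notin> K" and zg: "z \<in> path_image g" using z meet by (auto simp: open_arc_def)
  then obtain r where r: "0 < r" "ball z r \<subseteq> - K"
    using K by (meson ComplI open_Compl open_contains_ball)
  have "z \<in> closure In" "z \<in> closure Out" using J(11,12) zg by (auto simp: frontier_def)
  then obtain p q where p: "p \<in> In" "dist p z < r" and q: "q \<in> Out" "dist q z < r"
    using r(1) closure_approachable by metis
  have pq: "p \<in> ball z r" "q \<in> ball z r" using p q by (auto simp: dist_commute)
  show thesis
  proof (rule that[of p q])
    show "connected_component (- K) p q"
      using pq r(2) unfolding connected_component_def by (intro exI[of _ "ball z r"]) auto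
    show "p \<notin> K \<union> path_image g" "q \<notin> K \<union> path_image g"
      using pq r(2) p q J(10) by blast+
    show "\<not> connected_component (- (K \<union> path_image g)) p q"
    proof
      assume "connected_component (- (K \<union> path_image g)) p q"
      then obtain T where T: "connected T" "T \<subseteq> - (K \<union> path_image g)" "p \<in> T" "q \<in> T"
        by (auto simp: connected_component_def)
      have "T \<subseteq> In \<union> Out" using T(2) J(1,10) by blast
      then show False
        using connectedD[OF T(1) J(5,6)] J(9) T p q by blast
    qed
  qed
qed

text \<open>Two of the three points lie on the same side of the Jordan curve through \<open>g\<close>. So neither \<open>K\<close> nor the curve
separates them, and, as \<open>K\<close> meets the curve in the connected set \<open>P\<close>, Janiszewski's theorem
says that their union does not separate them either.\<close>

lemma closing_arc_three_sides:
  fixes K :: "complex set"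
  assumes g: "arc g" and meet: "K \<inter> path_image g = {pathstart g, pathfinish g}" and K: "compact K"
    and pc: "path_component K (pathstart g) (pathfinish g)"
    and x: "\<And>i. i \<in> {a, b, c} \<Longrightarrow> i \<notin> K \<union> path_image g"
    and con: "connected_component (- K) a b" "connected_component (- K) a c"
  shows "connected_component (- (K \<union> path_image g)) a b \<or> connected_component (- (K \<union> path_image g)) a c
       \<or> connected_component (- (K \<union> path_image g)) b c"
proof -
  obtain P In Out where J: "P \<subseteq> K" "compact P" "connected P" "{pathstart g, pathfinish g} \<subseteq> P"
    "open In" "open Out" "connected In" "connected Out"
    "In \<inter> Out = {}" "In \<union> Out = - (P \<union> path_image g)"
    "frontier In = P \<union> path_image g" "frontier Out = P \<union> path_image g"
    using theta_cycle[OF g meet pc] by (elim exE conjE)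
  have same: "connected_component (- (K \<union> path_image g)) s t"
    if st: "connected_component (- K) s t" "s \<in> H" "t \<in> H" and H: "H = In \<or> H = Out" for s t H
  proof -
    have HJ: "connected H" "H \<subseteq> - (P \<union> path_image g)" using H J(7,8,10) by auto
    have "connected_component (- (P \<union> path_image g)) s t"
      unfolding connected_component_def using HJ st by blast
    moreover have "K \<inter> (P \<union> path_image g) = P" using J(1,4) meet by blast
    moreover have "closed (P \<union> path_image g)"
      using J(2) g by (simp add: arc_imp_path closed_Un closed_path_image compact_imp_closed)
    moreover have "K \<union> (P \<union> path_image g) = K \<union> path_image g" using J(1) by blast
    ultimately show ?thesis
      using Janiszewski[OF K, of "P \<union> path_image g" s t] J(3) st(1) by simp
  qed
  have in_out: "i \<in> In \<or> i \<in> Out" if "i \<in> {a, b, c}" for i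
    using x[OF that] J(1,10) by blast
  have bc: "connected_component (- K) b c"
    using con connected_component_sym connected_component_trans by metis
  have "a \<in> In \<or> a \<in> Out" "b \<in> In \<or> b \<in> Out" "c \<in> In \<or> c \<in> Out" by (rule in_out; simp)+
  then show ?thesis
    using same[OF con(1), of In] same[OF con(2), of In] same[OF bc, of In]
      same[OF con(1), of Out] same[OF con(2), of Out] same[OF bc, of Out] by argo
qed

text \<open>Two applications of Janiszewski's theorem: each of the two compact sets meets what has been added before
in a single point.\<close>

lemma joining_arc_sides:
  fixes K1 K2 :: "complex set"
  assumes g: "arc g" and K: "compact K1" "compact K2" "K1 \<inter> K2 = {}"
    and meet: "K1 \<inter> path_image g = {pathstart g}" "K2 \<inter> path_image g = {pathfinish g}"
    and con: "connected_component (- (K1 \<union> K2)) a b" and ab: "a \<notin> path_image g" "b \<notin> path_image g"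
  shows "connected_component (- (K1 \<union> K2 \<union> path_image g)) a b"
proof -
  have cg: "closed (path_image g)" using g by (simp add: arc_imp_path closed_path_image)
  have "connected (- path_image g)" using g by (intro connected_arc_complement) auto
  then have "connected_component (- path_image g) a b"
    using ab unfolding connected_component_def by blast
  moreover have "connected_component (- K1) a b" "connected_component (- K2) a b"
    using con connected_component_of_subset[of "- (K1 \<union> K2)"] by blast+
  ultimately have "connected_component (- (K1 \<union> path_image g)) a b"
    using Janiszewski[OF K(1) cg] meet(1) by simp
  moreover have "K2 \<inter> (K1 \<union> path_image g) = {pathfinish g}" using meet(2) K(3) by blast
  moreover have "closed (K1 \<union> path_image g)" using K(1) cg by (simp add: closed_Un compact_imp_closed)
  ultimately have "connected_component (- (K2 \<union> (K1 \<union> path_image g))) a b"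
    using Janiszewski[OF K(2), of "K1 \<union> path_image g" a b] \<open>connected_component (- K2) a b\<close> by simp
  then show ?thesis by (simp add: Un_ac)
qed

lemma singleton_traces:
  assumes "(K1 \<union> K2) \<inter> P = {x, y}" "K1 \<inter> K2 = {}" "x \<in> K1" "y \<in> K2"
  shows "K1 \<inter> P = {x}" "K2 \<inter> P = {y}"
  using assms by blast+

section \<open>Plane drawings and their faces\<close>

lemma card_image_less:
  assumes "finite A" "g ` A = B" "x \<in> A" "y \<in> A" "x \<noteq> y" "g x = g y"
  shows "card B < card A"
proof -
  have "card B \<le> card A" using assms(1,2) card_image_le by blast
  moreover have "card B \<noteq> card A"
    using eq_card_imp_inj_on[OF assms(1), of g] assms(2-6) by (auto simp: inj_on_def)
  ultimately show ?thesis by linarith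
qed

locale plane_graph =
  fixes V :: "'a set" and E :: "'a set set" and pos :: "'a \<Rightarrow> complex" and \<gamma> :: "'a set \<Rightarrow> real \<Rightarrow> complex"
  assumes graph: "simple_graph V E" and drawing: "plane_drawing V E pos \<gamma>"
begin

abbreviation points :: "'a set set \<Rightarrow> complex set" where
  "points F \<equiv> drawing_points V F pos \<gamma>"

lemma finite_graph: "finite V" "finite E"
  using graph_finite[OF graph] by auto

lemma inj_pos: "inj_on pos V"
  using drawing by (simp add: plane_drawing_def)

lemma edge_curve:
  assumes "e \<in> E"
  shows "arc (\<gamma> e)" "{pathstart (\<gamma> e), pathfinish (\<gamma> e)} = pos ` e" "path_image (\<gamma> e) \<inter> pos ` V = pos ` e"
  using assms drawing by (auto simp: plane_drawing_def)

lemma edges_meet: "e \<in> E \<Longrightarrow> f \<in> E \<Longrightarrow> e \<noteq> f \<Longrightarrow> path_image (\<gamma> e) \<inter> path_image (\<gamma> f) = pos ` (e \<inter> f)"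
  using drawing by (auto simp: plane_drawing_def)

lemma edge_sub: "e \<in> E \<Longrightarrow> e \<subseteq> V"
  using graph by (auto simp: simple_graph_def)

lemma edge_ends:
  assumes "e \<in> E"
  shows "\<exists>u v. e = {u, v} \<and> u \<in> V \<and> v \<in> V \<and> u \<noteq> v \<and> pathstart (\<gamma> e) = pos u \<and> pathfinish (\<gamma> e) = pos v"
proof -
  obtain a b where ab: "e = {a, b}" "a \<noteq> b"
    using assms graph by (auto simp: simple_graph_def card_2_iff)
  have "a \<in> V" "b \<in> V" using ab edge_sub[OF assms] by auto
  moreover have "pathstart (\<gamma> e) = pos a \<and> pathfinish (\<gamma> e) = pos b \<or>
      pathstart (\<gamma> e) = pos b \<and> pathfinish (\<gamma> e) = pos a"
    using edge_curve(2)[OF assms] ab(1) by (auto simp: doubleton_eq_iff)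
  ultimately show ?thesis using ab by (metis insert_commute)
qed

lemma points_insert: "points (insert e F) = points F \<union> path_image (\<gamma> e)"
  by (auto simp: drawing_points_def)

lemma points_mono: "F \<subseteq> F' \<Longrightarrow> points F \<subseteq> points F'"
  by (auto simp: drawing_points_def)

lemma compact_drawing:
  assumes "X \<subseteq> V" "F \<subseteq> E" shows "compact (drawing_points X F pos \<gamma>)"
proof -
  have "finite X" "finite F" using assms finite_graph by (auto intro: finite_subset)
  moreover have "compact (path_image (\<gamma> e))" if "e \<in> F" for e
    using edge_curve(1)[of e] that assms by (blast intro: compact_path_image arc_imp_path)
  ultimately show ?thesis unfolding drawing_points_def
    by (intro compact_Un compact_UN) (simp_all add: finite_imp_compact)
qed

lemma closed_points: "F \<subseteq> E \<Longrightarrow> closed (points F)"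
  using compact_drawing[of V F] compact_imp_closed by blast

lemma points_meet_edge:
  assumes "e \<in> E" "F \<subseteq> E" "e \<notin> F"
  shows "points F \<inter> path_image (\<gamma> e) = pos ` e"
proof -
  have "path_image (\<gamma> f) \<inter> path_image (\<gamma> e) \<subseteq> pos ` e" if "f \<in> F" for f
    using edges_meet[of f e] that assms by blast
  then show ?thesis using edge_curve(3)[OF assms(1)] by (auto simp: drawing_points_def)
qed

lemma points_meet_ends:
  assumes "e \<in> E" "F \<subseteq> E" "e \<notin> F"
  shows "points F \<inter> path_image (\<gamma> e) = {pathstart (\<gamma> e), pathfinish (\<gamma> e)}"
  using points_meet_edge[OF assms] edge_curve(2)[OF assms(1)] by simp

lemma open_edge:
  assumes "e \<in> E"
  shows "open_arc (\<gamma> e) \<subseteq> points E" and "F \<subseteq> E \<Longrightarrow> e \<notin> F \<Longrightarrow> open_arc (\<gamma> e) \<subseteq> - points F"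
proof -
  show "open_arc (\<gamma> e) \<subseteq> points E" using assms unfolding open_arc_def drawing_points_def by blast
  show "open_arc (\<gamma> e) \<subseteq> - points F" if "F \<subseteq> E" "e \<notin> F"
    using points_meet_ends[OF assms that] unfolding open_arc_def by blast
qed

text \<open>A vertex set \<open>X\<close> that is a union of connected components of the graph with edge set \<open>F\<close>.\<close>

definition splits :: "'a set set \<Rightarrow> 'a set \<Rightarrow> bool" where
  "splits F X \<longleftrightarrow> (\<forall>f\<in>F. f \<subseteq> X \<or> f \<inter> X = {})"

lemma points_split:
  assumes "splits F X" "X \<subseteq> V" "F \<subseteq> E"
  shows "points F = drawing_points X {f \<in> F. f \<subseteq> X} pos \<gamma> \<union> drawing_points (V - X) {f \<in> F. f \<inter> X = {}} pos \<gamma>"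
    and "drawing_points X {f \<in> F. f \<subseteq> X} pos \<gamma> \<inter> drawing_points (V - X) {f \<in> F. f \<inter> X = {}} pos \<gamma> = {}"
proof -
  show "points F = drawing_points X {f \<in> F. f \<subseteq> X} pos \<gamma> \<union> drawing_points (V - X) {f \<in> F. f \<inter> X = {}} pos \<gamma>"
    using assms by (force simp: splits_def drawing_points_def)
  have inj: "pos a \<noteq> pos b" if "a \<in> X" "b \<in> V - X" for a b
    using inj_pos that assms(2) by (auto simp: inj_on_def)
  have ve: "pos x \<notin> path_image (\<gamma> f)" if "x \<in> V" "f \<in> F" "x \<notin> f" for x f
  proof
    assume "pos x \<in> path_image (\<gamma> f)"
    then have "pos x \<in> pos ` f" using edge_curve(3)[of f] that assms(3) by blast
    then show False using that edge_sub[of f] assms(3) inj_pos by (auto simp: inj_on_def)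
  qed
  have ee: "path_image (\<gamma> f) \<inter> path_image (\<gamma> h) = {}" if "f \<in> F" "h \<in> F" "f \<subseteq> X" "h \<inter> X = {}" for f h
  proof -
    have "f \<inter> h = {}" using that by blast
    moreover have "f \<noteq> {}" using edge_ends[of f] that(1) assms(3) by blast
    ultimately show ?thesis using edges_meet[of f h] that assms(3) by auto
  qed
  show "drawing_points X {f \<in> F. f \<subseteq> X} pos \<gamma> \<inter> drawing_points (V - X) {f \<in> F. f \<inter> X = {}} pos \<gamma> = {}"
  proof (rule equals0I)
    fix y assume "y \<in> drawing_points X {f \<in> F. f \<subseteq> X} pos \<gamma> \<inter> drawing_points (V - X) {f \<in> F. f \<inter> X = {}} pos \<gamma>"
    then have "(\<exists>a\<in>X. y = pos a) \<or> (\<exists>f\<in>F. f \<subseteq> X \<and> y \<in> path_image (\<gamma> f))"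
      "(\<exists>a\<in>V - X. y = pos a) \<or> (\<exists>f\<in>F. f \<inter> X = {} \<and> y \<in> path_image (\<gamma> f))"
      by (auto simp: drawing_points_def)
    then show False using inj ve ee assms(2) by (smt (verit, best) DiffD1 DiffD2 disjoint_iff subsetD)
  qed
qed

text \<open>The edge meets the part of the drawing that belongs to \<open>X\<close> in one of its ends, and the remaining part in
the other end.\<close>

lemma joining_edge_keeps_faces:
  assumes "splits F X" "X \<subseteq> V" "F \<subseteq> E" "e \<in> E" "e \<notin> F" "e \<inter> X \<noteq> {}" "\<not> e \<subseteq> X"
    and con: "connected_component (- points F) a b" and ab: "a \<notin> path_image (\<gamma> e)" "b \<notin> path_image (\<gamma> e)"
  shows "connected_component (- points (insert e F)) a b"
proof -
  obtain u v where e: "e = {u, v}" "u \<in> V" "v \<in> V" "u \<noteq> v"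
    "pathstart (\<gamma> e) = pos u" "pathfinish (\<gamma> e) = pos v"
    using edge_ends[OF assms(4)] by (elim exE conjE)
  define K1 where "K1 = drawing_points X {f \<in> F. f \<subseteq> X} pos \<gamma>"
  define K2 where "K2 = drawing_points (V - X) {f \<in> F. f \<inter> X = {}} pos \<gamma>"
  have K: "points F = K1 \<union> K2" "K1 \<inter> K2 = {}" using points_split[OF assms(1-3)] by (simp_all add: K1_def K2_def)
  have c: "compact K1" "compact K2" unfolding K1_def K2_def using assms(2,3) by (intro compact_drawing; blast)+
  have p: "pos x \<in> K1" if "x \<in> X" for x using that by (simp add: K1_def drawing_points_def)
  have q: "pos x \<in> K2" if "x \<in> V - X" for x using that by (simp add: K2_def drawing_points_def)
  have g: "arc (\<gamma> e)" using edge_curve assms by blast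
  have m: "(K1 \<union> K2) \<inter> path_image (\<gamma> e) = {pos u, pos v}"
    using points_meet_ends[OF assms(4,3,5)] K e by simp
  have "connected_component (- (K1 \<union> K2 \<union> path_image (\<gamma> e))) a b"
  proof (cases "u \<in> X")
    case True
    then have v: "v \<in> V - X" using e assms(7) by blast
    have "K1 \<inter> path_image (\<gamma> e) = {pos u}" "K2 \<inter> path_image (\<gamma> e) = {pos v}"
      using singleton_traces[OF m K(2) p[OF True] q[OF v]] by simp_all
    note this[folded e(5,6)]
    from joining_arc_sides[OF g c K(2) this con[unfolded K(1)] ab] show ?thesis .
  next
    case False
    then have u: "v \<in> X" "u \<in> V - X" using e assms(6) by blast+
    have "K2 \<inter> path_image (\<gamma> e) = {pos u}" "K1 \<inter> path_image (\<gamma> e) = {pos v}"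
      using singleton_traces[OF m[unfolded insert_commute[of "pos u"]] K(2) p[OF u(1)] q[OF u(2)]] by simp_all
    note this[folded e(5,6)]
    moreover have "K2 \<inter> K1 = {}" "connected_component (- (K2 \<union> K1)) a b"
      using K(2) con[unfolded K(1)] by (simp_all add: Int_commute Un_commute)
    ultimately have "connected_component (- (K2 \<union> K1 \<union> path_image (\<gamma> e))) a b"
      by (intro joining_arc_sides[OF g c(2,1) _ _ _ _ ab])
    then show ?thesis by (simp add: Un_commute)
  qed
  then show ?thesis by (simp add: K points_insert)
qed

text \<open>The edges that lie on the frontier of the face \<open>C\<close>. The ends of an edge are left out because a face can
touch a vertex without touching all edges at this vertex.\<close>

definition boundary :: "complex set \<Rightarrow> 'a set set" where
  "boundary C = {e \<in> E. closure C \<inter> open_arc (\<gamma> e) \<noteq> {}}"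

lemma reachable_splits:
  assumes "F \<subseteq> E"
  shows "splits F {w \<in> V. path_component (points F) x (pos w)}"
  unfolding splits_def
proof
  fix f assume f: "f \<in> F"
  obtain a b where e: "f = {a, b}" "a \<in> V" "b \<in> V" "pathstart (\<gamma> f) = pos a" "pathfinish (\<gamma> f) = pos b"
    using edge_ends[of f] f assms by auto
  have "path (\<gamma> f)" using edge_curve(1) f assms arc_imp_path by blast
  moreover have "path_image (\<gamma> f) \<subseteq> points F" using f by (auto simp: drawing_points_def)
  ultimately have "path_component (points F) (pos a) (pos b)"
    using e unfolding path_component_def by blast
  then have "path_component (points F) x (pos a) \<longleftrightarrow> path_component (points F) x (pos b)"
    by (metis path_component_sym path_component_trans)
  then show "f \<subseteq> {w \<in> V. path_component (points F) x (pos w)} \<or> f \<inter> {w \<in> V. path_component (points F) x (pos w)} = {}"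
    using e by auto
qed

text \<open>All faces that touch \<open>e\<close> lie in the same face of the drawing without \<open>e\<close>. Putting \<open>e\<close> back leaves this
face connected if \<open>e\<close> joins two components of the graph, and otherwise splits it into at most two.\<close>

lemma edge_touches_two_faces:
  assumes e: "e \<in> E" and C: "\<And>C. C \<in> {C1, C2, C3} \<Longrightarrow> C \<in> components (- points E) \<and> e \<in> boundary C"
  shows "C1 = C2 \<or> C1 = C3 \<or> C2 = C3"
proof -
  define F where "F = E - {e}"
  have F: "F \<subseteq> E" "e \<notin> F" "insert e F = E" using e by (auto simp: F_def)
  obtain u v where uv: "e = {u, v}" "u \<in> V" "v \<in> V" "u \<noteq> v"
    "pathstart (\<gamma> e) = pos u" "pathfinish (\<gamma> e) = pos v"
    using edge_ends[OF e] by (elim exE conjE)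
  note g = edge_curve(1)[OF e] and meet = points_meet_ends[OF e F(1,2)]
  have all: "points E = points F \<union> path_image (\<gamma> e)" using points_insert[of e F] F by simp
  obtain z where z: "z \<in> open_arc (\<gamma> e)" using open_arc_nonempty[OF g] by blast
  have pick: "\<exists>x. x \<in> C \<and> C = connected_component_set (- points E) x \<and>
      connected_component (- points F) z x \<and> x \<notin> points F \<union> path_image (\<gamma> e)"
    if "C \<in> {C1, C2, C3}" for C
  proof -
    have c: "C \<in> components (- points E)" "e \<in> boundary C" using C[OF that] by auto
    then obtain x where x: "x \<in> - points E" "C = connected_component_set (- points E) x"
      unfolding components_def by blast
    then have xC: "x \<in> C" by simp
    have "connected C" "C \<subseteq> - points E" using c in_components_connected in_components_subset by blast+
    moreover have "closure C \<inter> open_arc (\<gamma> e) \<noteq> {}" using c by (simp add: boundary_def)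
    ultimately have "C \<subseteq> connected_component_set (- points F) z"
      using component_touching_arc[OF g meet closed_points[OF F(1)] _ _ _ z] all by blast
    then show ?thesis using x xC all by (intro exI[of _ x]) auto
  qed
  obtain a where a: "C1 = connected_component_set (- points E) a"
      "connected_component (- points F) z a" "a \<notin> points F \<union> path_image (\<gamma> e)" using pick[of C1] by blast
  obtain b where b: "C2 = connected_component_set (- points E) b"
      "connected_component (- points F) z b" "b \<notin> points F \<union> path_image (\<gamma> e)" using pick[of C2] by blast
  obtain c where c: "C3 = connected_component_set (- points E) c"
      "connected_component (- points F) z c" "c \<notin> points F \<union> path_image (\<gamma> e)" using pick[of C3] by blast
  have con: "connected_component (- points F) a b" "connected_component (- points F) a c"
    using a b c by (meson connected_component_sym connected_component_trans)+
  have "connected_component (- points E) a b \<or> connected_component (- points E) a c \<or>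
      connected_component (- points E) b c"
  proof (cases "path_component (points F) (pos u) (pos v)")
    case True
    then show ?thesis
      using closing_arc_three_sides[OF g meet compact_drawing[OF order_refl F(1)] _ _ con] uv(5,6) a(3) b(3) c(3)
      unfolding all by auto
  next
    case False
    define X where "X = {w \<in> V. path_component (points F) (pos u) (pos w)}"
    have sp: "splits F X" "X \<subseteq> V" using reachable_splits[OF F(1)] by (auto simp: X_def)
    have "pos u \<in> points F" using uv(2) by (simp add: drawing_points_def)
    then have "u \<in> X" using uv(2) by (simp add: X_def path_component_refl)
    moreover have "v \<notin> X" using False by (simp add: X_def)
    ultimately have "e \<inter> X \<noteq> {}" "\<not> e \<subseteq> X" unfolding uv(1) by blast+
    then have "connected_component (- points (insert e F)) a b"
      using a(3) b(3) by (intro joining_edge_keeps_faces[OF sp F(1) e F(2) _ _ con(1)]) blast+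
    then show ?thesis unfolding F(3) by (rule disjI1)
  qed
  moreover have "connected_component_set (- points E) x = connected_component_set (- points E) y"
    if "connected_component (- points E) x y" for x y
    using connected_component_eq[of y "- points E" x] that by simp
  ultimately show ?thesis unfolding a(1) b(1) c(1) by blast
qed

section \<open>Counting faces\<close>

text \<open>The connected components of the graph with edge set \<open>F\<close>, seen as subsets of the plane.\<close>

definition pieces :: "'a set set \<Rightarrow> complex set set" where
  "pieces F = (\<lambda>v. path_component_set (points F) (pos v)) ` V"

text \<open>Each piece of the larger drawing is a union of pieces of the smaller one together with points of new
edges, and contains at least one of them. So sending a piece to the one that contains it is surjective,
and the number of pieces does not grow.\<close>

lemma pieces_image:
  assumes "F \<subseteq> F'" shows "pieces F' = (\<lambda>T. \<Union>x\<in>T. path_component_set (points F') x) ` pieces F"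
    and "v \<in> V \<Longrightarrow> (\<Union>x\<in>path_component_set (points F) (pos v). path_component_set (points F') x)
          = path_component_set (points F') (pos v)"
proof -
  show *: "(\<Union>x\<in>path_component_set (points F) (pos v). path_component_set (points F') x)
          = path_component_set (points F') (pos v)" if "v \<in> V" for v
  proof -
    have "pos v \<in> path_component_set (points F) (pos v)"
      using that by (simp add: path_component_refl drawing_points_def)
    moreover have "path_component_set (points F') x = path_component_set (points F') (pos v)"
      if "x \<in> path_component_set (points F) (pos v)" for x
    proof -
      have "path_component (points F') (pos v) x"
        using that path_component_of_subset[OF points_mono[OF assms]] by blast
      then show ?thesis using path_component_eq[of x "points F'" "pos v"] by simp
    qed
    ultimately show ?thesis by blast
  qed
  show "pieces F' = (\<lambda>T. \<Union>x\<in>T. path_component_set (points F') x) ` pieces F"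
    unfolding pieces_def image_image using * by (intro image_cong) auto
qed

lemma finite_pieces: "finite (pieces F)"
  by (simp add: pieces_def finite_graph)

lemma pieces_mono: "F \<subseteq> F' \<Longrightarrow> card (pieces F') \<le> card (pieces F)"
  using pieces_image(1)[of F F'] card_image_le[OF finite_pieces, of _ F] by simp

lemma pieces_drop:
  assumes "e = {u, v}" "u \<in> V" "v \<in> V" "e \<in> E" "pathstart (\<gamma> e) = pos u" "pathfinish (\<gamma> e) = pos v"
    and sep: "\<not> path_component (points F) (pos u) (pos v)"
  shows "card (pieces (insert e F)) < card (pieces F)"
proof (rule card_image_less[OF finite_pieces])
  let ?pc = "\<lambda>F w. path_component_set (points F) (pos w)"
  note im = pieces_image[of F "insert e F"]
  show "(\<lambda>T. \<Union>x\<in>T. path_component_set (points (insert e F)) x) ` pieces F = pieces (insert e F)"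
    using im(1) by blast
  show "?pc F u \<in> pieces F" "?pc F v \<in> pieces F" using assms(2,3) by (auto simp: pieces_def)
  have "path_component (points F) (pos v) (pos v)"
    using assms(3) by (simp add: path_component_refl drawing_points_def)
  then show "?pc F u \<noteq> ?pc F v" using sep by auto
  have "path (\<gamma> e)" "path_image (\<gamma> e) \<subseteq> points (insert e F)"
    using edge_curve(1)[OF assms(4)] by (simp_all add: arc_imp_path points_insert)
  then have "path_component (points (insert e F)) (pos u) (pos v)"
    using assms(5,6) unfolding path_component_def by blast
  then have "?pc (insert e F) v = ?pc (insert e F) u"
    using path_component_eq[of "pos v" "points (insert e F)" "pos u"] by simp
  then show "(\<Union>x\<in>?pc F u. path_component_set (points (insert e F)) x) =
      (\<Union>x\<in>?pc F v. path_component_set (points (insert e F)) x)"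
    using im(2)[OF _ assms(2)] im(2)[OF _ assms(3)] by auto
qed

text \<open>A face is open and not empty, so that an additional arc does not cover it.\<close>

lemma component_survives:
  assumes "F \<subseteq> E" "e \<in> E" "C \<in> components (- points F)"
  shows "\<exists>C'. C' \<in> components (- points (insert e F)) \<and> C' \<subseteq> C"
proof -
  have "open C" using assms(3) closed_points[OF assms(1)] open_components by blast
  moreover have "C \<noteq> {}" using assms(3) in_components_nonempty by blast
  ultimately obtain x where x: "x \<in> C" "x \<notin> path_image (\<gamma> e)"
    using arc_no_interior[OF edge_curve(1)[OF assms(2)], of C] by blast
  have xF: "x \<in> - points (insert e F)"
    using x assms(3) in_components_subset by (fastforce simp: points_insert)
  let ?C = "connected_component_set (- points (insert e F)) x"
  have "?C \<in> components (- points (insert e F))" using xF by (simp add: componentsI)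
  moreover have "?C \<subseteq> C"
  proof (rule components_maximal[OF assms(3)])
    have "?C \<subseteq> - points (insert e F)" by (rule connected_component_subset)
    then show "?C \<subseteq> - points F" by (auto simp: points_insert)
    have "x \<in> ?C" using xF by (simp add: connected_component_refl)
    then show "C \<inter> ?C \<noteq> {}" using x(1) by blast
  qed simp
  ultimately show ?thesis by blast
qed

lemma no_edges_connected_complement: "connected (- points {})"
proof -
  have "finite (points {})" using finite_graph by (simp add: drawing_points_def)
  then have "connected (UNIV - points {})" by (intro connected_open_delete_finite) auto
  then show ?thesis by (simp add: Compl_eq_Diff_UNIV)
qed

text \<open>Euler's inequality: the number of faces is at least $|F| - |V| + 1 + c$ where $c$ is the number of
connected components. Only finitely many faces are exhibited, which avoids proving that there are
no more. An additional edge either decreases $c$ or, by \<open>closing_arc_separates\<close>, splits a face.\<close>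

lemma many_faces:
  assumes "F \<subseteq> E"
  shows "\<exists>\<C>. finite \<C> \<and> \<C> \<subseteq> components (- points F) \<and>
    card F + 1 + card (pieces F) \<le> card \<C> + card V"
  using finite_subset[OF assms finite_graph(2)] assms
proof (induction F rule: finite_induct)
  case empty
  have "finite (points {})" using finite_graph by (simp add: drawing_points_def)
  then have "infinite (- points {})" using infinite_UNIV_char_0 by (simp add: finite_compl)
  then have "- points {} \<noteq> {}" by (rule infinite_imp_nonempty)
  moreover note no_edges_connected_complement
  ultimately have "components (- points {}) = {- points {}}" using components_eq_sing_iff[of "- points {}"] by simp
  moreover have "card (pieces {}) \<le> card V"
    unfolding pieces_def using finite_graph by (intro card_image_le)
  ultimately show ?case by (intro exI[of _ "{- points {}}"]) simp
next
  case (insert e F)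
  have F: "F \<subseteq> E" and e: "e \<in> E" using insert.prems by auto
  obtain \<C> where \<C>: "finite \<C>" "\<C> \<subseteq> components (- points F)"
    "card F + 1 + card (pieces F) \<le> card \<C> + card V"
    using insert.IH F by blast
  obtain \<phi> where \<phi>: "\<And>C. C \<in> components (- points F) \<Longrightarrow> \<phi> C \<in> components (- points (insert e F)) \<and> \<phi> C \<subseteq> C"
    using component_survives[OF F e] by metis
  have inj: "inj_on \<phi> (components (- points F))"
  proof (rule inj_onI)
    fix C C' assume C: "C \<in> components (- points F)" "C' \<in> components (- points F)" "\<phi> C = \<phi> C'"
    have "\<phi> C \<noteq> {}" "\<phi> C \<subseteq> C \<inter> C'" using \<phi>[OF C(1)] \<phi>[OF C(2)] C(3) in_components_nonempty by auto
    then show "C = C'" using components_nonoverlap[OF C(1,2)] by blast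
  qed
  obtain u v where uv: "e = {u, v}" "u \<in> V" "v \<in> V" "u \<noteq> v"
    "pathstart (\<gamma> e) = pos u" "pathfinish (\<gamma> e) = pos v"
    using edge_ends[OF e] by (elim exE conjE)
  show ?case
  proof (cases "path_component (points F) (pos u) (pos v)")
    case False
    have "card (\<phi> ` \<C>) = card \<C>" using inj \<C>(2) by (intro card_image) (rule inj_on_subset)
    moreover have "card (pieces (insert e F)) < card (pieces F)"
      using pieces_drop[OF uv(1-3) e uv(5,6) False] .
    moreover have "\<phi> ` \<C> \<subseteq> components (- points (insert e F))" using \<phi> \<C>(2) by blast
    ultimately show ?thesis using \<C>(1,3) insert.hyps
      by (intro exI[of _ "\<phi> ` \<C>"]) simp
  next
    case True
    then have "path_component (points F) (pathstart (\<gamma> e)) (pathfinish (\<gamma> e))" using uv by simp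
    from closing_arc_separates[OF edge_curve(1)[OF e] points_meet_ends[OF e F insert.hyps(2)] closed_points[OF F] this]
    obtain p q where pq: "connected_component (- points F) p q" "p \<notin> points (insert e F)" "q \<notin> points (insert e F)"
      "\<not> connected_component (- points (insert e F)) p q"
      unfolding points_insert by blast
    let ?pc = "connected_component_set (- points (insert e F))"
    define C0 where "C0 = connected_component_set (- points F) p"
    have pF: "p \<in> - points F" using pq by (simp add: points_insert)
    have C0: "C0 \<in> components (- points F)" "p \<in> C0" "q \<in> C0"
      using pF pq(1) by (simp_all add: C0_def componentsI connected_component_refl)
    have new: "?pc p \<in> components (- points (insert e F))" "?pc q \<in> components (- points (insert e F))"
      "p \<in> ?pc p" "q \<in> ?pc q"
      using pq by (simp_all add: componentsI connected_component_refl)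
    have ne: "?pc p \<noteq> ?pc q" using new(4) pq(4) by auto
    have out: "x \<notin> \<phi> C" if "C \<in> \<C> - {C0}" "x \<in> {p, q}" for C x
    proof
      assume "x \<in> \<phi> C"
      then have "x \<in> C \<inter> C0" using \<phi>[of C] that \<C>(2) C0 by auto
      then show False using components_nonoverlap[of C "- points F" C0] that(1) \<C>(2) C0(1) by auto
    qed
    have notin: "?pc p \<notin> \<phi> ` (\<C> - {C0})" "?pc q \<notin> \<phi> ` (\<C> - {C0})"
      using out new(3,4) by (metis (no_types, lifting) imageE insertCI)+
    have "card (\<phi> ` (\<C> - {C0})) = card (\<C> - {C0})"
      using inj \<C>(2) by (intro card_image) (blast intro: inj_on_subset)
    then have "card (insert (?pc p) (insert (?pc q) (\<phi> ` (\<C> - {C0})))) = card (\<C> - {C0}) + 2"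
      using \<C>(1) notin ne by simp
    moreover have "card \<C> \<le> card (\<C> - {C0}) + 1"
      using \<C>(1) by (cases "C0 \<in> \<C>") (simp_all add: card_Diff_singleton)
    moreover have "card (pieces (insert e F)) \<le> card (pieces F)" by (intro pieces_mono) blast
    moreover have "insert (?pc p) (insert (?pc q) (\<phi> ` (\<C> - {C0}))) \<subseteq> components (- points (insert e F))"
      using new(1,2) \<phi> \<C>(2) by blast
    ultimately show ?thesis using \<C>(1,3) insert.hyps
      by (intro exI[of _ "insert (?pc p) (insert (?pc q) (\<phi> ` (\<C> - {C0})))"]) simp
  qed
qed

text \<open>An edge that is the first to reach one of its ends does not separate the plane. With two edges, this
holds for each of them in turn, since different edges of a simple graph do not have both ends in
common.\<close>

lemma two_edges_connected_complement:
  assumes "B \<subseteq> E" "card B \<le> 2"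
  shows "connected (- points B)"
proof -
  note empty = no_edges_connected_complement
  have join: "connected (- points (insert e F))"
    if "connected (- points F)" "splits F X" "X \<subseteq> V" "F \<subseteq> E" "e \<in> E" "e \<notin> F" "e \<inter> X \<noteq> {}" "\<not> e \<subseteq> X"
    for e F X
    unfolding connected_iff_connected_component
  proof (intro ballI)
    fix a b assume ab: "a \<in> - points (insert e F)" "b \<in> - points (insert e F)"
    then have "connected_component (- points F) a b"
      using that(1) by (simp add: connected_iff_connected_component points_insert)
    then show "connected_component (- points (insert e F)) a b"
      using joining_edge_keeps_faces[OF that(2-8)] ab by (simp add: points_insert)
  qed
  have one: "connected (- points {e})" if e: "e \<in> E" for e
  proof -
    obtain u v where "e = {u, v}" "u \<in> V" "u \<noteq> v" using edge_ends[OF e] by blast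
    then show ?thesis using join[OF empty, of "{u}" e] e by (simp add: splits_def)
  qed
  have "finite B" using assms finite_graph finite_subset by blast
  consider "B = {}" | e where "B = {e}" | e f where "B = {e, f}" "e \<noteq> f"
  proof -
    have "card B = 0 \<or> card B = 1 \<or> card B = 2" using assms(2) by linarith
    then show thesis using that \<open>finite B\<close> by (auto simp: card_1_singleton_iff card_2_iff)
  qed
  then show ?thesis
  proof cases
    case 1 then show ?thesis using empty by simp
  next
    case 2 then show ?thesis using one assms by simp
  next
    case 3
    obtain a b where f: "f = {a, b}" "a \<in> V" "b \<in> V" "a \<noteq> b" using edge_ends[of f] 3 assms by blast
    obtain c d where e: "e = {c, d}" "c \<noteq> d" using edge_ends[of e] 3 assms by blast
    have "\<exists>x\<in>V. x \<in> f \<and> x \<notin> e" using 3 f e by (auto simp: doubleton_eq_iff)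
    then obtain x where x: "x \<in> V" "x \<in> f" "x \<notin> e" by blast
    have "connected (- points (insert f {e}))"
    proof (rule join[OF one, of _ "{x}"])
      show "\<not> f \<subseteq> {x}" using f by auto
    qed (use x 3 assms in \<open>auto simp: splits_def\<close>)
    then show ?thesis using 3 by (simp add: insert_commute)
  qed
qed

text \<open>A larger face of the smaller drawing would meet the frontier of \<open>C\<close> outside \<open>F\<close>, in an inner point
of an edge, which then belongs to the boundary.\<close>

lemma boundary_component:
  assumes C: "C \<in> components (- points E)" and F: "boundary C \<subseteq> F" "F \<subseteq> E"
  shows "C \<in> components (- points F)"
proof -
  obtain x where x: "x \<in> C" using C in_components_nonempty by blast
  have sub: "C \<subseteq> - points F" using in_components_subset[OF C] points_mono[OF F(2)] by blast
  then have xF: "x \<in> - points F" using x by blast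
  define C' where "C' = connected_component_set (- points F) x"
  have C': "C' \<in> components (- points F)" "x \<in> C'"
    using xF by (simp_all add: C'_def componentsI connected_component_refl)
  have le: "C \<subseteq> C'" unfolding C'_def
    using in_components_connected[OF C] x sub by (intro connected_component_maximal)
  have "C' \<subseteq> C"
  proof (rule ccontr)
    assume "\<not> C' \<subseteq> C"
    moreover have "connected C'" by (simp add: C'_def)
    ultimately have "C' \<inter> frontier C \<noteq> {}"
      using connected_Int_frontier[of C' C] C'(2) x by blast
    then obtain y where y: "y \<in> C'" "y \<in> frontier C" by blast
    have "frontier C \<subseteq> points E"
      using frontier_of_components_closed_complement[OF closed_points[OF order_refl] C] .
    moreover have "y \<notin> points F" using y(1) in_components_subset[OF C'(1)] by blast
    ultimately have "y \<in> points E" "y \<notin> points F" using y(2) by blast+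
    then obtain e where e: "e \<in> E" "e \<notin> F" "y \<in> path_image (\<gamma> e)" "y \<notin> pos ` V"
      unfolding drawing_points_def by blast
    have "y \<in> open_arc (\<gamma> e)" using e edge_curve(2)[OF e(1)] edge_sub[OF e(1)] by (auto simp: open_arc_def)
    moreover have "y \<in> closure C" using y(2) by (simp add: frontier_def)
    ultimately have "e \<in> boundary C" using e(1) by (auto simp: boundary_def)
    then show False using e(2) F(1) by blast
  qed
  then show ?thesis using le C'(1) by (simp add: antisym)
qed

text \<open>Otherwise \<open>C\<close> is the whole complement of its boundary, which contains a further edge.\<close>

lemma boundary_eq_all_edges:
  assumes C: "C \<in> components (- points E)" and conn: "connected (- points (boundary C))"
  shows "boundary C = E"
proof (rule ccontr)
  assume "boundary C \<noteq> E"
  then obtain e where e: "e \<in> E" "e \<notin> boundary C" by (auto simp: boundary_def)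
  have sub: "boundary C \<subseteq> E" by (auto simp: boundary_def)
  have "C \<in> components (- points (boundary C))" using boundary_component[OF C _ sub] by simp
  moreover from this have "- points (boundary C) \<noteq> {}"
    using in_components_nonempty in_components_subset by blast
  ultimately have "C = - points (boundary C)"
    using conn components_eq_sing_iff[of "- points (boundary C)"] by simp
  then have "open_arc (\<gamma> e) \<subseteq> C" using open_edge(2)[OF e(1) sub e(2)] by simp
  then show False
    using open_edge(1)[OF e(1)] in_components_subset[OF C] open_arc_nonempty[OF edge_curve(1)[OF e(1)]] by blast
qed

text \<open>One or two edges do not separate the plane, so that a face bounded by them alone is bounded by all
edges.\<close>

lemma face_has_three_edges:
  assumes "3 \<le> card E" "C \<in> components (- points E)"
  shows "3 \<le> card (boundary C)"
proof (rule ccontr)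
  assume n: "\<not> 3 \<le> card (boundary C)"
  have "boundary C \<subseteq> E" by (auto simp: boundary_def)
  then have "boundary C = E"
    using boundary_eq_all_edges[OF assms(2)] two_edges_connected_complement n by simp
  then show False using n assms(1) by simp
qed

lemma boundary_double_count:
  assumes "finite \<C>" "\<C> \<subseteq> components (- points E)"
  shows "(\<Sum>C\<in>\<C>. card (boundary C)) \<le> 2 * card E"
proof -
  have two: "card {C \<in> \<C>. e \<in> boundary C} \<le> 2" if "e \<in> E" for e
  proof (rule ccontr)
    assume "\<not> ?thesis"
    then have "3 \<le> card {C \<in> \<C>. e \<in> boundary C}" by simp
    then obtain T where "T \<subseteq> {C \<in> \<C>. e \<in> boundary C}" "card T = 3"
      by (rule obtain_subset_with_card_n)
    then obtain C1 C2 C3 where "{C1, C2, C3} \<subseteq> {C \<in> \<C>. e \<in> boundary C}" "C1 \<noteq> C2" "C1 \<noteq> C3" "C2 \<noteq> C3"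
      unfolding card_3_iff by blast
    then show False using edge_touches_two_faces[OF that, of C1 C2 C3] assms(2) by blast
  qed
  have "(\<Sum>C\<in>\<C>. card (boundary C)) = (\<Sum>C\<in>\<C>. \<Sum>e\<in>E. if e \<in> boundary C then 1 else 0)"
  proof (rule sum.cong)
    fix C have "boundary C = {e \<in> E. e \<in> boundary C}" by (auto simp: boundary_def)
    then show "card (boundary C) = (\<Sum>e\<in>E. if e \<in> boundary C then 1 else 0)"
      using finite_graph(2) by (simp add: sum.If_cases Int_def)
  qed simp
  also have "\<dots> = (\<Sum>e\<in>E. \<Sum>C\<in>\<C>. if e \<in> boundary C then 1 else 0)" by (rule sum.swap)
  also have "\<dots> = (\<Sum>e\<in>E. card {C \<in> \<C>. e \<in> boundary C})"
    using assms(1) by (simp add: sum.If_cases Int_def)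
  also have "\<dots> \<le> (\<Sum>e\<in>E. 2)" by (intro sum_mono two)
  finally show ?thesis by simp
qed

lemma pieces_positive: "V \<noteq> {} \<Longrightarrow> 1 \<le> card (pieces F)"
  using finite_pieces[of F] by (simp add: Suc_le_eq card_gt_0_iff) (simp add: pieces_def)

text \<open>With $f$ faces, double counting gives $3 f \leq 2 |E|$, and Euler's inequality $|E| + 2 \leq f + |V|$.\<close>

theorem planar_edge_bound:
  assumes "V \<noteq> {}" shows "card E < 3 * card V"
proof (cases "3 \<le> card E")
  case False
  have "1 \<le> card V" using assms finite_graph by (simp add: Suc_le_eq card_gt_0_iff)
  then show ?thesis using False by simp
next
  case True
  obtain \<C> where \<C>: "finite \<C>" "\<C> \<subseteq> components (- points E)"
    "card E + 1 + card (pieces E) \<le> card \<C> + card V"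
    using many_faces[OF order_refl] by blast
  have "3 * card \<C> = (\<Sum>C\<in>\<C>. 3)" by simp
  also have "\<dots> \<le> (\<Sum>C\<in>\<C>. card (boundary C))"
    using face_has_three_edges[OF True] \<C>(2) by (intro sum_mono) blast
  finally show ?thesis using boundary_double_count[OF \<C>(1,2)] \<C>(3) pieces_positive[OF assms, of E] by linarith
qed

end

section \<open>The unbounded face of an outerplanar drawing\<close>

lemma open_arc_dense: "arc g \<Longrightarrow> path_image g \<subseteq> closure (open_arc g)"
proof -
  assume g: "arc g"
  have "continuous_on (closure {0<..<1}) g"
    using g by (simp add: arc_def path_def)
  then have "g ` closure {0<..<1} \<subseteq> closure (open_arc g)"
    by (rule image_closure_subset) (auto simp: open_arc_image[OF g] closure_subset[THEN subsetD])
  then show ?thesis by (simp add: path_image_def)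
qed

lemma degree_sum:
  assumes "simple_graph V E" "F \<subseteq> E"
  shows "(\<Sum>v\<in>V. card {e \<in> F. v \<in> e}) = 2 * card F"
proof -
  have fin: "finite V" "finite F" using graph_finite[OF assms(1)] assms(2) finite_subset by auto
  have "(\<Sum>v\<in>V. card {e \<in> F. v \<in> e}) = (\<Sum>v\<in>V. \<Sum>e\<in>F. if v \<in> e then 1 else 0)"
    using fin by (simp add: sum.If_cases Int_def)
  also have "\<dots> = (\<Sum>e\<in>F. \<Sum>v\<in>V. if v \<in> e then 1 else 0)" by (rule sum.swap)
  also have "\<dots> = (\<Sum>e\<in>F. 2)"
  proof (rule sum.cong)
    fix e assume "e \<in> F"
    then have e: "e \<subseteq> V" "card e = 2" using assms by (auto simp: simple_graph_def)
    have "{v \<in> V. v \<in> e} = e" using e by blast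
    then show "(\<Sum>v\<in>V. if v \<in> e then 1 else 0) = (2::nat)"
      using fin e by (simp add: sum.If_cases Int_def)
  qed simp
  finally show ?thesis by simp
qed

context plane_graph begin
text \<open>Suppose that at most one edge of the boundary of \<open>C\<close> ends in \<open>v\<close>, and let \<open>h\<close> be another edge at \<open>v\<close>. Then
the boundary does not separate \<open>C\<close> from \<open>h\<close>: the part \<open>L\<close> of it at \<open>v\<close>, a point or an arc, does not
separate the plane, the remaining part \<open>K2\<close> is closed and avoids \<open>v\<close>, so that it does not separate points near
\<open>v\<close>, and both parts meet in at most one point. So \<open>C\<close> contains points of \<open>h\<close>, which is absurd.\<close>

lemma boundary_at_vertex:
  assumes C: "C \<in> components (- points E)" and v: "v \<in> V" "pos v \<in> closure C"
    and deg: "2 \<le> card {e \<in> E. v \<in> e}"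
  shows "2 \<le> card {e \<in> boundary C. v \<in> e}"
proof (rule ccontr)
  assume few: "\<not> 2 \<le> card {e \<in> boundary C. v \<in> e}"
  define B where "B = boundary C"
  have BE: "B \<subseteq> E" by (auto simp: B_def boundary_def)
  have fin: "finite {e \<in> B. v \<in> e}" using BE finite_graph(2) by (auto intro: finite_subset)
  define F0 where "F0 = {e \<in> B. v \<notin> e}"
  define K2 where "K2 = drawing_points (V - {v}) F0 pos \<gamma>"
  have F0: "F0 \<subseteq> E" using BE by (auto simp: F0_def)
  have cK: "compact K2" unfolding K2_def using F0 by (intro compact_drawing) auto
  have vK: "pos v \<notin> K2"
  proof -
    have "pos v \<notin> pos ` (V - {v})" using inj_pos v(1) by (auto simp: inj_on_def)
    moreover have "pos v \<notin> path_image (\<gamma> f)" if "f \<in> F0" for f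
    proof
      assume "pos v \<in> path_image (\<gamma> f)"
      then have "pos v \<in> pos ` f" using edge_curve(3)[of f] that F0 v(1) by blast
      then have "v \<in> f" using inj_pos v(1) edge_sub[of f] that F0 by (auto simp: inj_on_def)
      then show False using that by (simp add: F0_def)
    qed
    ultimately show ?thesis by (auto simp: K2_def drawing_points_def)
  qed
  obtain h where h: "h \<in> E" "h \<notin> B" "v \<in> h"
  proof -
    have "\<not> {e \<in> E. v \<in> e} \<subseteq> {e \<in> B. v \<in> e}"
      using card_mono[OF fin, of "{e \<in> E. v \<in> e}"] deg few by (auto simp: B_def)
    then show thesis using that by blast
  qed
  have "\<exists>L. closed L \<and> pos v \<in> L \<and> connected (- L) \<and> connected (K2 \<inter> L) \<and> K2 \<union> L = points B"
  proof (cases "{e \<in> B. v \<in> e} = {}")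
    case True
    then have "F0 = B" by (auto simp: F0_def)
    then have "K2 \<union> {pos v} = points B" using v(1) by (auto simp: K2_def drawing_points_def)
    moreover have "connected (- {pos v})"
      using connected_open_delete_finite[of UNIV "{pos v}"] connected_UNIV by (simp add: Compl_eq_Diff_UNIV)
    ultimately show ?thesis using vK by (intro exI[of _ "{pos v}"]) simp
  next
    case False
    then have "card {e \<in> B. v \<in> e} \<noteq> 0" using fin by simp
    then have "card {e \<in> B. v \<in> e} = 1" using few unfolding B_def by linarith
    then obtain g where g: "{e \<in> B. v \<in> e} = {g}" using card_1_singleton_iff[of "{e \<in> B. v \<in> e}"] by auto
    then have gB: "g \<in> B" "v \<in> g" "g \<notin> F0" and gE: "g \<in> E" using BE by (auto simp: F0_def)
    have B: "B = insert g F0" using g by (auto simp: F0_def)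
    obtain w where w: "g = {v, w}" "w \<in> V" "w \<noteq> v" using edge_ends[OF gE] gB(2) by auto
    have vg: "pos v \<in> path_image (\<gamma> g)" using edge_curve(3)[OF gE] gB(2) by blast
    have P: "points F0 = insert (pos v) K2" using v(1) by (auto simp: K2_def drawing_points_def)
    have m: "insert (pos v) K2 \<inter> path_image (\<gamma> g) = {pos v, pos w}"
      using points_meet_edge[OF gE F0 gB(3)] w(1) P by simp
    have "pos w \<noteq> pos v" using inj_pos w v(1) by (auto simp: inj_on_def)
    have "K2 \<inter> path_image (\<gamma> g) = insert (pos v) K2 \<inter> path_image (\<gamma> g) - {pos v}" using vK by blast
    also have "\<dots> = {pos w}" unfolding m using \<open>pos w \<noteq> pos v\<close> by auto
    finally have "K2 \<inter> path_image (\<gamma> g) = {pos w}" .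
    moreover have "K2 \<union> path_image (\<gamma> g) = points B"
      unfolding B points_insert P using vg by blast
    moreover have "connected (- path_image (\<gamma> g))"
      using edge_curve(1)[OF gE] by (intro connected_arc_complement) auto
    moreover have "closed (path_image (\<gamma> g))"
      using edge_curve(1)[OF gE] by (simp add: arc_imp_path closed_path_image)
    ultimately show ?thesis using vg by (intro exI[of _ "path_image (\<gamma> g)"]) simp
  qed
  then obtain L where L: "closed L" "pos v \<in> L" "connected (- L)" "connected (K2 \<inter> L)" "K2 \<union> L = points B"
    by (elim exE conjE)
  obtain r where r: "0 < r" "ball (pos v) r \<subseteq> - K2"
    using cK vK by (meson ComplI compact_imp_closed open_Compl open_contains_ball)
  have "pos v \<in> closure (open_arc (\<gamma> h))"
    using open_arc_dense[OF edge_curve(1)[OF h(1)]] edge_curve(3)[OF h(1)] h(3) by blast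
  \<comment> \<open>Both \<open>h\<close> and \<open>C\<close> come arbitrarily close to \<open>v\<close>.\<close>
  then obtain y where y: "y \<in> open_arc (\<gamma> h)" "dist y (pos v) < r"
    using r(1) closure_approachable by blast
  obtain c where c: "c \<in> C" "dist c (pos v) < r" using v(2) r(1) closure_approachable by blast
  have CB: "C \<in> components (- points B)" using boundary_component[OF C _ BE] by (simp add: B_def)
  have out: "y \<in> - points B" "c \<in> - points B"
    using open_edge(2)[OF h(1) BE h(2)] y(1) in_components_subset[OF CB] c(1) by blast+
  have "connected_component (- L) c y"
    using L(3,5) out unfolding connected_component_def by (intro exI[of _ "- L"]) blast
  moreover have "connected_component (- K2) c y"
    unfolding connected_component_def using r(2) c(2) y(2)
    by (intro exI[of _ "ball (pos v) r"]) (simp add: dist_commute)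
  ultimately have "connected_component (- (K2 \<union> L)) c y"
    using Janiszewski[OF cK L(1), of c y] L(4) by simp
  then obtain T where T: "connected T" "T \<subseteq> - points B" "c \<in> T" "y \<in> T"
    unfolding connected_component_def L(5) by blast
  then have "T \<subseteq> C" using components_maximal[OF CB T(1,2)] c(1) by blast
  then show False
    using T(4) y(1) open_edge(1)[OF h(1)] in_components_subset[OF C] by blast
qed

text \<open>The unbounded face has at least $|V|$ edges, since each vertex has two incident edges on it, and every
other face has at least three. So $3 (f - 1) + |V| \leq 2 |E|$, to be combined with
$|E| + 2 \leq f + |V|$.\<close>

lemma outer_edge_bound_min_degree:
  assumes "V \<noteq> {}" and deg: "\<And>v. v \<in> V \<Longrightarrow> 2 \<le> card {e \<in> E. v \<in> e}"
    and outer: "pos ` V \<subseteq> closure (outside (points E))"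
  shows "card E \<le> 2 * card V"
proof (cases "3 \<le> card E")
  case False
  have "1 \<le> card V" using assms finite_graph by (simp add: Suc_le_eq card_gt_0_iff)
  then show ?thesis using False by simp
next
  case True
  define U where "U = outside (points E)"
  have bd: "bounded (points E)" using compact_drawing[of V E] compact_imp_bounded by blast
  have U: "U \<in> components (- points E)"
    unfolding U_def using outside_in_components[of "points E"] unbounded_outside[OF bd] connected_outside[OF bd] by auto
  obtain \<C>0 where \<C>0: "finite \<C>0" "\<C>0 \<subseteq> components (- points E)"
    "card E + 1 + card (pieces E) \<le> card \<C>0 + card V"
    using many_faces[OF order_refl] by blast
  \<comment> \<open>The faces counted by Euler's inequality need not include the unbounded one.\<close>
  define \<C> where "\<C> = insert U \<C>0"
  have \<C>: "finite \<C>" "\<C> \<subseteq> components (- points E)" "U \<in> \<C>"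
    using \<C>0 U by (auto simp: \<C>_def)
  have "card \<C>0 \<le> card \<C>" unfolding \<C>_def using \<C>0(1) by (intro card_mono) auto
  then have faces: "card E + 2 \<le> card \<C> + card V"
    using \<C>0(3) pieces_positive[OF assms(1), of E] by linarith
  have "2 * card V = (\<Sum>v\<in>V. 2)" by simp
  also have "\<dots> \<le> (\<Sum>v\<in>V. card {e \<in> boundary U. v \<in> e})"
    using boundary_at_vertex[OF U _ _ deg] outer by (intro sum_mono) (auto simp: U_def)
  also have "\<dots> = 2 * card (boundary U)"
    by (rule degree_sum[OF graph]) (auto simp: boundary_def)
  finally have big: "card V \<le> card (boundary U)" by simp
  have "3 * (card \<C> - 1) = (\<Sum>C\<in>\<C> - {U}. 3)" using \<C> by simp
  also have "\<dots> \<le> (\<Sum>C\<in>\<C> - {U}. card (boundary C))"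
    using face_has_three_edges[OF True] \<C>(2) by (intro sum_mono) blast
  finally have "3 * (card \<C> - 1) + card V \<le> (\<Sum>C\<in>\<C>. card (boundary C))"
    using big sum.remove[OF \<C>(1,3), of "\<lambda>C. card (boundary C)"] by linarith
  then show ?thesis using boundary_double_count[OF \<C>(1,2)] faces by linarith
qed

end

lemma plane_graph_restrict:
  assumes "plane_graph V E pos \<gamma>" "X \<subseteq> V"
  shows "plane_graph X {e \<in> E. e \<subseteq> X} pos \<gamma>"
proof
  interpret plane_graph V E pos \<gamma> by fact
  show "simple_graph X {e \<in> E. e \<subseteq> X}"
    using graph assms(2) by (auto simp: simple_graph_def intro: finite_subset)
  have "path_image (\<gamma> e) \<inter> pos ` X = pos ` e" if "e \<in> E" "e \<subseteq> X" for e
    using edge_curve(3)[OF that(1)] assms(2) that(2) by blast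
  then show "plane_drawing X {e \<in> E. e \<subseteq> X} pos \<gamma>"
    using inj_on_subset[OF inj_pos assms(2)] edge_curve(1,2) edges_meet
    unfolding plane_drawing_def by simp
qed

text \<open>The closure instead of the frontier: this is equivalent, as vertices are not outside the drawing, and
it is obviously inherited by subdrawings.\<close>

definition outer_drawing where
  "outer_drawing V E pos \<gamma> \<longleftrightarrow> plane_graph V E pos \<gamma> \<and> pos ` V \<subseteq> closure (outside (drawing_points V E pos \<gamma>))"

lemma outer_drawing_restrict:
  assumes "outer_drawing V E pos \<gamma>" "X \<subseteq> V"
  shows "outer_drawing X {e \<in> E. e \<subseteq> X} pos \<gamma>"
proof -
  have "drawing_points X {e \<in> E. e \<subseteq> X} pos \<gamma> \<subseteq> drawing_points V E pos \<gamma>"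
    using assms(2) by (auto simp: drawing_points_def)
  then have "closure (outside (drawing_points V E pos \<gamma>)) \<subseteq> closure (outside (drawing_points X {e \<in> E. e \<subseteq> X} pos \<gamma>))"
    by (intro closure_mono outside_mono)
  moreover have "pos ` X \<subseteq> pos ` V" using assms(2) by blast
  ultimately have "pos ` X \<subseteq> closure (outside (drawing_points X {e \<in> E. e \<subseteq> X} pos \<gamma>))"
    using assms(1) unfolding outer_drawing_def by (meson order_trans)
  then show ?thesis
    using plane_graph_restrict[OF _ assms(2)] assms(1) unfolding outer_drawing_def by simp
qed

theorem outer_edge_bound:
  assumes "outer_drawing V E pos \<gamma>"
  shows "card E \<le> 2 * card V"
proof -
  have "finite V" using assms plane_graph.finite_graph by (auto simp: outer_drawing_def)
  then show ?thesis using assms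
  proof (induction V arbitrary: E rule: finite_psubset_induct)
    case (psubset V)
    interpret plane_graph V E pos \<gamma> using psubset.prems by (simp add: outer_drawing_def)
    show ?case
    proof (cases "\<exists>v\<in>V. \<not> 2 \<le> card {e \<in> E. v \<in> e}")
      case True
      then obtain v where v: "v \<in> V" "card {e \<in> E. v \<in> e} \<le> 1" by auto
      let ?E = "{e \<in> E. e \<subseteq> V - {v}}"
      have "card ?E \<le> 2 * card (V - {v})"
        using psubset.IH[of "V - {v}" ?E] outer_drawing_restrict[OF psubset.prems, of "V - {v}"] v(1) by blast
      moreover have "E = ?E \<union> {e \<in> E. v \<in> e}" using edge_sub by auto
      then have "card E \<le> card ?E + card {e \<in> E. v \<in> e}" using card_Un_le by metis
      moreover have "card V = card (V - {v}) + 1" using card_Suc_Diff1[OF finite_graph(1) v(1)] by simp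
      ultimately show ?thesis using v(2) by linarith
    next
      case False
      show ?thesis
      proof (cases "V = {}")
        case True
        then have "e \<notin> E" for e using edge_ends[of e] by auto
        then have "E = {}" by blast
        then show ?thesis by simp
      next
        case ne: False
        then show ?thesis
        proof (rule outer_edge_bound_min_degree)
          show "pos ` V \<subseteq> closure (outside (points E))" using psubset.prems by (simp add: outer_drawing_def)
          show "2 \<le> card {e \<in> E. v \<in> e}" if "v \<in> V" for v using False that by simp
        qed
      qed
    qed
  qed
qed

section \<open>The theorem\<close>

theorem theorem1p5:
  fixes V :: "'a set" and E :: "'a set set"
  assumes "simple_graph V E"
    and "colorable 3 V E"
    and "planar V E"
  shows "proper_orientation_number V E \<le> 11 \<and>
    (outerplanar V E \<longrightarrow> proper_orientation_number V E \<le> 10)"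
proof
  obtain pos \<gamma> where "plane_drawing V E pos \<gamma>" using assms(3) by (auto simp: planar_def)
  then have plane: "plane_graph V E pos \<gamma>" using assms(1) by (simp add: plane_graph.intro)
  have sparse: "card {e \<in> E. e \<subseteq> X} < 3 * card X" if "X \<subseteq> V" "X \<noteq> {}" for X
    using plane_graph.planar_edge_bound[OF plane_graph_restrict[OF plane that(1)] that(2)] .
  have dense: "card {e \<in> E. e \<subseteq> X} \<le> 3 * card X" if "X \<subseteq> V" for X
  proof (cases "X = {}")
    case True
    then have "{e \<in> E. e \<subseteq> X} = {}" using assms(1) by (auto simp: simple_graph_def)
    then show ?thesis by (metis card.empty zero_le)
  next
    case False then show ?thesis using sparse[OF that] by simp
  qed
  show "proper_orientation_number V E \<le> 11"
    using proper_orientation_number_le[OF assms(1,2) dense sparse] by simp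
  show "outerplanar V E \<longrightarrow> proper_orientation_number V E \<le> 10"
  proof
    assume "outerplanar V E"
    then obtain pos \<gamma> where d: "plane_drawing V E pos \<gamma>"
      "pos ` V \<subseteq> frontier (outside (drawing_points V E pos \<gamma>))"
      unfolding outerplanar_def by blast
    then have "outer_drawing V E pos \<gamma>"
      using assms(1) by (auto simp: outer_drawing_def frontier_def plane_graph.intro)
    then have "card {e \<in> E. e \<subseteq> X} \<le> 2 * card X" if "X \<subseteq> V" for X
      using outer_edge_bound[OF outer_drawing_restrict[OF _ that]] by blast
    from proper_orientation_number_le[OF assms(1,2) this sparse]
    show "proper_orientation_number V E \<le> 10" by simp
  qed
qed

end
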